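(* Let $d\ge1$ and fix a finite set $X=\{x_0,\dots,x_n\}\subset\mathbb{T}_{\pm}^d$. Then, for every $y_1,y_2\in\mathbb{T}_{\pm}^d$ such that $x_0\in\mathrm{conv}_{TO}(y_1,y_2)$, we have $$\mathrm{conv}_{TC}(X\cup\{y_1\})\cap\mathrm{conv}_{TC}(X\cup\{y_2\})=\mathrm{conv}_{TC}(X).$$
   Context: Signed tropical numbers. Let $\mathbb{O}=-\infty$ be the tropical zero. $\mathbb{T}_{>\mathbb{O}}=\mathbb{R}$ (positive numbers), $\mathbb{T}_{<\mathbb{O}}=\{\ominus r: r\in\mathbb{R}\}$ (negative numbers), $\mathbb{T}_{\ge\mathbb{O}}=\mathbb{R}\cup\{\mathbb{O}\}$, $\mathbb{T}_{\pm}=\mathbb{T}_{>\mathbb{O}}\cup\mathbb{T}_{<\mathbb{O}}\cup\{\mathbb{O}\}$, balanced numbers $\mathbb{T}_{\bullet}=\{\bullet r: r\in\mathbb{R}\}\cup\{\mathbb{O}\}$, symmetrized semiring $\mathbb{S}=\mathbb{T}_{\pm}\cup\mathbb{T}_{\bullet}$. The norm is $|r|=|\ominus r|=|\bullet r|=r$ and $|\mathbb{O}|=\mathbb{O}$; the sign $\mathrm{tsgn}$ takes values in $\{\oplus,\ominus,\bullet,\mathbb{O}\}$. Addition on $\mathbb{S}$: $x\oplus y$ equals $x$ if $|x|>|y|$, $y$ if $|y|>|x|$, $x$ if $|x|=|y|$ and $\mathrm{tsgn}(x)=\mathrm{tsgn}(y)$, and $\bullet|x|$ if $|x|=|y|$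 and the signs differ. Multiplication: $x\odot y$ has norm $|x|+|y|$ and sign the product of signs (with $\oplus,\ominus,\bullet$ multiplying like $1,-1,0$); $\mathbb{O}$ is absorbing. The multiplicative unit is the real number $0$. Operations extend to vectors in the usual way. Order on $\mathbb{T}_{\pm}$: $x>y$ iff $x\oplus(\ominus y)\in\mathbb{T}_{>\mathbb{O}}$ (a total order). TO-convex hull of two points. For $s\in\mathbb{S}$, $\mathcal{U}(s)=\{x\in\mathbb{T}_{\pm}:\ominus|s|\le x\le|s|\}$ if $s\in\mathbb{T}_{\bullet}$ and $\mathcal{U}(s)=\{s\}$ otherwise; for vectors $\mathcal{U}(s)=\prod_i\mathcal{U}(s_i)$. $\mathrm{conv}_{TO}(y_1,y_2)=\bigcup\{\mathcal{U}(\lambda\odot y_1\oplus\mu\odot y_2):\lambda,\mu\in\mathbb{T}_{\ge\mathbb{O}},\ \lambda\oplus\mu=0\}$. TC-convexity. For $a=(a_0,\dots,a_d)\in\mathbb{T}_{\pm}^{d+1}$ with $(a_1,\dots,a_d)\ne(\mathbb{O},\dots,\mathbb{O})$, the closed halfspace is $\overline{\mathcal{H}}^+(a)=\{x\in\mathbb{T}_{\pm}^d: a_0\oplus a_1\odot x_1\oplus\dots\oplus a_d\odot x_d\in\mathbb{T}_{>\mathbb{O}}\cup\mathbb{T}_{\bullet}\}$. For two points $x,y\in\mathbb{T}_{\pm}^d$, $\mathrm{conv}_{TC}(x,y)$ is the intersection of all closed halfspaces containing both. A set $S$ is TC-convex if $\mathrm{conv}_{TC}(x,y)\subseteq S$ for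 all $x,y\in S$. For $M\subseteq\mathbb{T}_{\pm}^d$, $\mathrm{conv}_{TC}(M)$ is the intersection of all TC-convex sets containing $M$. *)

theory Defs
  imports "HOL-Analysis.Cartesian_Space"
begin

datatype tsign = TPlus | TMinus | TBal

fun tsign_mult :: "tsign \<Rightarrow> tsign \<Rightarrow> tsign" where
  "tsign_mult TBal t = TBal"
| "tsign_mult s TBal = TBal"
| "tsign_mult TPlus t = t"
| "tsign_mult TMinus TPlus = TMinus"
| "tsign_mult TMinus TMinus = TPlus"

lemma tsign_mult_commute: "tsign_mult s t = tsign_mult t s"
  by (cases s; cases t) auto

lemma tsign_mult_assoc: "tsign_mult (tsign_mult s t) u = tsign_mult s (tsign_mult t u)"
  by (cases s; cases t; cases u) auto

lemma tsign_mult_TBal [simp]: "tsign_mult s TBal = TBal"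
  by (cases s) auto

lemma tsign_mult_TPlus [simp]: "tsign_mult TPlus s = s"
  by (cases s) auto

lemma tsign_mult_cancel: "tsign_mult s u = tsign_mult t u \<Longrightarrow> s = t \<or> u = TBal"
  by (cases u; cases s; cases t) auto

text \<open>
  The symmetrized tropical semiring: \<open>TZero\<close> is the tropical zero (minus infinity), and
  \<open>TNum s r\<close> has sign \<open>s\<close> and norm \<open>r\<close>. It is an instance of
  \<^class>\<open>comm_semiring_1\<close>, so on this type the class constant \<open>0\<close> is the tropical
  zero, whereas \<open>1\<close> is the positive number whose norm is the real number 0.
\<close>

datatype symtrop = TZero | TNum tsign real

text \<open>In the addition, the comparison of norms involving the tropical zero is resolved by
  the first two equations.\<close>

fun symtrop_add :: "symtrop \<Rightarrow> symtrop \<Rightarrow> symtrop" where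
  "symtrop_add TZero y = y"
| "symtrop_add x TZero = x"
| "symtrop_add (TNum s p) (TNum t q) =
    (if p > q then TNum s p
     else if q > p then TNum t q
     else if s = t then TNum s p
     else TNum TBal p)"

fun symtrop_mult :: "symtrop \<Rightarrow> symtrop \<Rightarrow> symtrop" where
  "symtrop_mult TZero y = TZero"
| "symtrop_mult x TZero = TZero"
| "symtrop_mult (TNum s p) (TNum t q) = TNum (tsign_mult s t) (p + q)"

fun symtrop_uminus :: "symtrop \<Rightarrow> symtrop" where
  "symtrop_uminus TZero = TZero"
| "symtrop_uminus (TNum s p) = TNum (tsign_mult TMinus s) p"

instantiation symtrop :: comm_semiring_1
begin

definition zero_symtrop :: symtrop where "0 = TZero"
definition one_symtrop :: symtrop where "1 = TNum TPlus 0"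
definition plus_symtrop :: "symtrop \<Rightarrow> symtrop \<Rightarrow> symtrop" where "x + y = symtrop_add x y"
definition times_symtrop :: "symtrop \<Rightarrow> symtrop \<Rightarrow> symtrop" where "x * y = symtrop_mult x y"

instance
proof
  fix a b c :: symtrop
  show "a + b + c = a + (b + c)"
    unfolding plus_symtrop_def by (cases a; cases b; cases c) auto
  show "a + b = b + a"
    unfolding plus_symtrop_def by (cases a; cases b) auto
  show "0 + a = a"
    unfolding plus_symtrop_def zero_symtrop_def by simp
  show "a * b * c = a * (b * c)"
    unfolding times_symtrop_def by (cases a; cases b; cases c) (auto simp: tsign_mult_assoc)
  show "a * b = b * a"
    unfolding times_symtrop_def by (cases a; cases b) (auto simp: tsign_mult_commute)
  show "1 * a = a"
    unfolding times_symtrop_def one_symtrop_def by (cases a) auto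
  show "(a + b) * c = a * c + b * c"
    unfolding times_symtrop_def plus_symtrop_def
    by (cases a; cases b; cases c)
      (auto dest: tsign_mult_cancel)
  show "0 * a = 0"
    unfolding times_symtrop_def zero_symtrop_def by simp
  show "a * 0 = 0"
    unfolding times_symtrop_def zero_symtrop_def by (cases a) auto
  show "(0::symtrop) \<noteq> 1"
    unfolding zero_symtrop_def one_symtrop_def by simp
qed

end

instantiation symtrop :: uminus
begin
definition uminus_symtrop :: "symtrop \<Rightarrow> symtrop" where "- x = symtrop_uminus x"
instance ..
end

definition T_pos :: "symtrop set" where
  "T_pos = range (TNum TPlus)"

definition T_neg :: "symtrop set" where
  "T_neg = range (TNum TMinus)"

definition T_nonneg :: "symtrop set" where
  "T_nonneg = T_pos \<union> {0}"

definition T_signed :: "symtrop set" where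
  "T_signed = T_pos \<union> T_neg \<union> {0}"

definition T_bal :: "symtrop set" where
  "T_bal = range (TNum TBal) \<union> {0}"

definition T_signed_vec :: "(symtrop ^ 'd) set" where
  "T_signed_vec = {x. \<forall>i. x $ i \<in> T_signed}"

text \<open>The norm, viewed as an element of the nonnegative tropical numbers inside
  \<^typ>\<open>symtrop\<close>.\<close>

fun tnorm :: "symtrop \<Rightarrow> symtrop" where
  "tnorm TZero = TZero"
| "tnorm (TNum s r) = TNum TPlus r"

text \<open>These relations are meant for arguments in \<open>T_signed\<close> only, where they form a total
  order.\<close>

definition tless :: "symtrop \<Rightarrow> symtrop \<Rightarrow> bool" where
  "tless y x \<longleftrightarrow> x + (- y) \<in> T_pos"

definition tle :: "symtrop \<Rightarrow> symtrop \<Rightarrow> bool" where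
  "tle y x \<longleftrightarrow> tless y x \<or> y = x"

definition U_set :: "symtrop \<Rightarrow> symtrop set" where
  "U_set s = (if s \<in> T_bal
     then {x \<in> T_signed. tle (- tnorm s) x \<and> tle x (tnorm s)}
     else {s})"

definition U_vec :: "symtrop ^ 'd \<Rightarrow> (symtrop ^ 'd) set" where
  "U_vec s = {x. \<forall>i. x $ i \<in> U_set (s $ i)}"

definition conv_TO :: "symtrop ^ 'd \<Rightarrow> symtrop ^ 'd \<Rightarrow> (symtrop ^ 'd) set" where
  "conv_TO y1 y2 =
     \<Union> {U_vec (l *s y1 + m *s y2) | l m. l \<in> T_nonneg \<and> m \<in> T_nonneg \<and> l + m = 1}"

text \<open>The coefficient vector of an affine halfspace is split into the constant term
  \<open>a0\<close> and the vector \<open>a\<close> of the remaining \<open>d\<close> coefficients.\<close>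

definition closed_halfspace :: "symtrop \<Rightarrow> symtrop ^ 'd \<Rightarrow> (symtrop ^ 'd) set" where
  "closed_halfspace a0 a =
     {x \<in> T_signed_vec. a0 + (\<Sum>i\<in>UNIV. a $ i * x $ i) \<in> T_pos \<union> T_bal}"

definition closed_halfspaces :: "(symtrop ^ 'd) set set" where
  "closed_halfspaces =
     {closed_halfspace a0 a | a0 a. a0 \<in> T_signed \<and> a \<in> T_signed_vec \<and> a \<noteq> 0}"

definition conv_TC2 :: "symtrop ^ 'd \<Rightarrow> symtrop ^ 'd \<Rightarrow> (symtrop ^ 'd) set" where
  "conv_TC2 x y = T_signed_vec \<inter> \<Inter> {H \<in> closed_halfspaces. x \<in> H \<and> y \<in> H}"

definition TC_convex :: "(symtrop ^ 'd) set \<Rightarrow> bool" where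
  "TC_convex S \<longleftrightarrow> S \<subseteq> T_signed_vec \<and> (\<forall>x\<in>S. \<forall>y\<in>S. conv_TC2 x y \<subseteq> S)"

definition conv_TC :: "(symtrop ^ 'd) set \<Rightarrow> (symtrop ^ 'd) set" where
  "conv_TC M = TC_convex hull M"

end

theory Submission imports Defs begin

text \<open>
  A signed tropical number becomes the real number of absolute value \<open>exp r\<close> carrying its sign, and
  a point becomes the ray of its homogenisation, whose extra coordinate is indexed by \<open>None\<close>. The key
  step is separation: a point outside the TC hull of a finite set \<open>X\<close> lies outside some closed
  halfspace \<open>H\<close> containing \<open>X\<close>. Given this, suppose \<open>z\<close> lies in both larger hulls but is separated from
  \<open>X\<close> by \<open>H\<close>. Then neither \<open>y1\<close> nor \<open>y2\<close> is in \<open>H\<close>; but the complement of \<open>H\<close> is an open halfspace,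
  hence TO-convex, so it contains \<open>x0\<close>, a contradiction.

  For separation, cones over TC hulls are closed under left sums (the larger absolute value wins) and
  under axis-parallel segments. If no halfspace with normal vector of sign pattern \<open>\<sigma>\<close> separates \<open>z\<close>,
  then left sums alone produce a point \<open>s\<close> of the cone with \<open>\<sigma> i * s i \<le> \<sigma> i * z i\<close> for all \<open>i\<close>.
  Axis-parallel segments merge these points, one for each \<open>\<sigma>\<close>, into \<open>z\<close> itself.
\<close>

section \<open>Left sums and weakly nonnegative vectors\<close>

text \<open>Tropical addition with ties given to the left argument, hence not commutative. Where the
  semiring sum would be balanced, the entry of \<open>s\<close> is taken.\<close>

definition left_sum :: "('i \<Rightarrow> real) \<Rightarrow> ('i \<Rightarrow> real) \<Rightarrow> 'i \<Rightarrow> real" where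
  "left_sum s t = (\<lambda>i. if \<bar>t i\<bar> \<le> \<bar>s i\<bar> then s i else t i)"

definition left_cone :: "('i \<Rightarrow> real) set \<Rightarrow> bool" where
  "left_cone S \<longleftrightarrow> (\<lambda>_. 0) \<in> S \<and> (\<forall>c>0. \<forall>s\<in>S. (\<lambda>i. c * s i) \<in> S) \<and> (\<forall>s\<in>S. \<forall>t\<in>S. left_sum s t \<in> S)"

text \<open>Only coordinates in \<open>E\<close> are controlled: \<open>S\<close> stands for its
  projection to \<open>E\<close>, so inductions can forget coordinates without changing the
  type.\<close>

definition tc_cone :: "'i set \<Rightarrow> ('i \<Rightarrow> real) set \<Rightarrow> bool" where
  "tc_cone E S \<longleftrightarrow> left_cone S \<and>
     (\<forall>s\<in>S. \<forall>t\<in>S. \<forall>i\<in>E. \<forall>v. (\<forall>j\<in>E - {i}. s j = t j) \<longrightarrow> s i \<le> v \<longrightarrow> v \<le> t i \<longrightarrow>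
        (\<exists>u\<in>S. (\<forall>j\<in>E - {i}. u j = s j) \<and> u i = v))"

text \<open>The real form of \<open>a \<odot> x \<in> T_pos \<union> T_bal\<close>: some positive term is at least as large as every
  negative one.\<close>

definition weakly_nonneg :: "'i set \<Rightarrow> ('i \<Rightarrow> real) \<Rightarrow> ('i \<Rightarrow> real) \<Rightarrow> bool" where
  "weakly_nonneg E a x \<longleftrightarrow> (\<forall>i\<in>E. a i * x i < 0 \<longrightarrow> (\<exists>j\<in>E. - (a i * x i) \<le> a j * x j))"

lemma left_cone_zero: "left_cone S \<Longrightarrow> (\<lambda>_. 0) \<in> S"
  and left_cone_scale: "left_cone S \<Longrightarrow> c > 0 \<Longrightarrow> s \<in> S \<Longrightarrow> (\<lambda>i. c * s i) \<in> S"
  and left_cone_left_sum: "left_cone S \<Longrightarrow> s \<in> S \<Longrightarrow> t \<in> S \<Longrightarrow> left_sum s t \<in> S"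
  by (simp_all add: left_cone_def)

lemma tc_cone_left_cone: "tc_cone E S \<Longrightarrow> left_cone S"
  by (simp add: tc_cone_def)

lemma tc_cone_segment:
  assumes "tc_cone E S" "s \<in> S" "t \<in> S" "i \<in> E" "\<And>j. j \<in> E \<Longrightarrow> j \<noteq> i \<Longrightarrow> s j = t j"
    and "s i \<le> v \<and> v \<le> t i \<or> t i \<le> v \<and> v \<le> s i"
  obtains u where "u \<in> S" "\<And>j. j \<in> E \<Longrightarrow> j \<noteq> i \<Longrightarrow> u j = s j" "u i = v"
proof -
  have ax: "\<exists>u\<in>S. (\<forall>j\<in>E - {i}. u j = s j) \<and> u i = v"
    if "s \<in> S" "t \<in> S" "\<forall>j\<in>E - {i}. s j = t j" "s i \<le> v" "v \<le> t i" for s t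
    using assms(1,4) that unfolding tc_cone_def by blast
  have 1: "\<forall>j\<in>E - {i}. s j = t j" "\<forall>j\<in>E - {i}. t j = s j"
    using assms(5) by auto
  from assms(6) have "\<exists>u\<in>S. (\<forall>j\<in>E - {i}. u j = s j) \<and> u i = v"
  proof
    assume "s i \<le> v \<and> v \<le> t i"
    then show ?thesis using ax[OF assms(2,3) 1(1)] by blast
  next
    assume "t i \<le> v \<and> v \<le> s i"
    then obtain u where "u \<in> S" "\<forall>j\<in>E - {i}. u j = t j" "u i = v"
      using ax[OF assms(3,2) 1(2)] by blast
    then show ?thesis using 1(1) by auto
  qed
  then show ?thesis using that by blast
qed

text \<open>Iterated left sum, starting from the zero vector; what is recorded about it does not
  depend on the order of summation.\<close>

lemma left_cone_family:
  assumes "left_cone S" "finite F" "\<And>n. n \<in> F \<Longrightarrow> g n \<in> S"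
  obtains u where "u \<in> S" "\<And>i n. n \<in> F \<Longrightarrow> \<bar>g n i\<bar> \<le> \<bar>u i\<bar>"
    "\<And>i. u i = 0 \<or> (\<exists>n\<in>F. u i = g n i)"
proof -
  have "\<exists>u\<in>S. (\<forall>i. \<forall>n\<in>F. \<bar>g n i\<bar> \<le> \<bar>u i\<bar>) \<and> (\<forall>i. u i = 0 \<or> (\<exists>n\<in>F. u i = g n i))"
    using assms(2,3)
  proof (induction F)
    case empty
    then show ?case using left_cone_zero[OF assms(1)] by (intro bexI[of _ "\<lambda>_. 0"]) auto
  next
    case (insert m F)
    then obtain u where u: "u \<in> S" "\<forall>i. \<forall>n\<in>F. \<bar>g n i\<bar> \<le> \<bar>u i\<bar>"
      "\<forall>i. u i = 0 \<or> (\<exists>n\<in>F. u i = g n i)" by auto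
    have "left_sum u (g m) \<in> S" using u(1) insert.prems assms(1) left_cone_left_sum by auto
    moreover have "\<forall>i. \<forall>n\<in>insert m F. \<bar>g n i\<bar> \<le> \<bar>left_sum u (g m) i\<bar>"
    proof (intro allI ballI)
      fix i n assume "n \<in> insert m F"
      then show "\<bar>g n i\<bar> \<le> \<bar>left_sum u (g m) i\<bar>"
        using u(2)[rule_format, of n i] by (cases "n = m") (auto simp: left_sum_def)
    qed
    moreover have "\<forall>i. left_sum u (g m) i = 0 \<or> (\<exists>n\<in>insert m F. left_sum u (g m) i = g n i)"
      using u(3) by (auto simp: left_sum_def)
    ultimately show ?case by blast
  qed
  then show ?thesis using that by blast
qed

lemma left_sum_diag: "d i \<noteq> 0 \<Longrightarrow> left_sum (\<lambda>i. d i * s i) (\<lambda>i. d i * t i) i = d i * left_sum s t i" for d :: "'i \<Rightarrow> real"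
  by (auto simp: left_sum_def abs_mult)

lemma left_cone_diag:
  assumes "left_cone S" "\<And>i. d i \<noteq> 0"
  shows "left_cone ((\<lambda>s i. d i * s i) ` S)"
proof -
  have "left_sum (\<lambda>i. d i * s i) (\<lambda>i. d i * t i) = (\<lambda>i. d i * left_sum s t i)" for s t
    using left_sum_diag assms(2) by fast
  moreover have "(\<lambda>i. c * (d i * s i)) = (\<lambda>i. d i * (c * s i))" for c s
    by (simp add: mult.left_commute)
  ultimately show ?thesis
    using assms(1) unfolding left_cone_def by (auto intro!: image_eqI[of _ _ "\<lambda>_. 0"])
qed

text \<open>Reflections and scalings normalise a target vector to ones. A negative
  \<open>d i\<close> swaps the ends of a segment, which \<open>tc_cone_segment\<close> allows
  for.\<close>

lemma tc_cone_diag: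
  assumes S: "tc_cone E S" and d: "\<And>i. d i \<noteq> 0"
  shows "tc_cone E ((\<lambda>s i. d i * s i) ` S)"
  unfolding tc_cone_def
proof (intro conjI ballI allI impI)
  show "left_cone ((\<lambda>s i. d i * s i) ` S)"
    using left_cone_diag tc_cone_left_cone S d by blast
  fix s' t' i v
  assume "s' \<in> (\<lambda>s i. d i * s i) ` S" "t' \<in> (\<lambda>s i. d i * s i) ` S" and i: "i \<in> E"
    and eq: "\<forall>j\<in>E - {i}. s' j = t' j" and le: "s' i \<le> v" "v \<le> t' i"
  then obtain s t where st: "s \<in> S" "t \<in> S" "s' = (\<lambda>i. d i * s i)" "t' = (\<lambda>i. d i * t i)"
    by auto
  have "s i \<le> v / d i \<and> v / d i \<le> t i \<or> t i \<le> v / d i \<and> v / d i \<le> s i"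
    using le d[of i] unfolding st by (cases "d i > 0") (auto simp: field_simps)
  moreover have "s j = t j" if "j \<in> E" "j \<noteq> i" for j
    using eq that d[of j] unfolding st by auto
  ultimately obtain u where u: "u \<in> S" "\<And>j. j \<in> E \<Longrightarrow> j \<noteq> i \<Longrightarrow> u j = s j" "u i = v / d i"
    using tc_cone_segment[OF S st(1,2) i] by metis
  show "\<exists>u\<in>(\<lambda>s i. d i * s i) ` S. (\<forall>j\<in>E - {i}. u j = s' j) \<and> u i = v"
    using u d[of i] unfolding st by (intro bexI[OF _ imageI[OF u(1)]]) auto
qed

section \<open>Stability of halfspaces under scaling, left sums and segments\<close>

lemma weakly_nonneg_diag: "weakly_nonneg E a (\<lambda>i. d i * x i) \<longleftrightarrow> weakly_nonneg E (\<lambda>i. d i * a i) x"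
  by (simp add: weakly_nonneg_def mult_ac)

lemma weakly_nonneg_scale:
  assumes c: "c > 0"
  shows "weakly_nonneg E a (\<lambda>i. c * x i) \<longleftrightarrow> weakly_nonneg E a x"
proof -
  have "a i * (c * x i) = c * (a i * x i)" for i by simp
  moreover have "c * p < 0 \<longleftrightarrow> p < 0" for p
    using c by (simp add: mult_less_0_iff)
  moreover have "- (c * p) \<le> c * q \<longleftrightarrow> - p \<le> q" for p q
    using c by (metis mult_le_cancel_left_pos mult_minus_right)
  ultimately show ?thesis unfolding weakly_nonneg_def by presburger
qed

lemma left_sum_pick:
  "left_sum s t i = s i \<and> \<bar>t i\<bar> \<le> \<bar>s i\<bar> \<or> left_sum s t i = t i \<and> \<bar>s i\<bar> < \<bar>t i\<bar>"
  by (auto simp: left_sum_def)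

lemma weakly_nonneg_iff:
  assumes "finite E" "E \<noteq> {}"
  shows "weakly_nonneg E a x \<longleftrightarrow> (\<exists>k\<in>E. \<forall>i\<in>E. \<bar>a i * x i\<bar> \<le> a k * x k)"
proof
  assume w: "weakly_nonneg E a x"
  obtain k where k: "k \<in> E" "\<And>i. i \<in> E \<Longrightarrow> a i * x i \<le> a k * x k"
  proof -
    let ?f = "\<lambda>i. a i * x i"
    have "Max (?f ` E) \<in> ?f ` E"
      using assms by (intro Max_in) auto
    then obtain k where k: "k \<in> E" "Max (?f ` E) = ?f k" by auto
    show ?thesis
    proof (rule that[OF k(1)])
      show "?f i \<le> ?f k" if "i \<in> E" for i
        using that assms(1) by (simp flip: k(2))
    qed
  qed
  have "\<bar>a i * x i\<bar> \<le> a k * x k" if i: "i \<in> E" for i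
  proof (cases "a i * x i < 0")
    case True
    then obtain j where "j \<in> E" "- (a i * x i) \<le> a j * x j"
      using w i unfolding weakly_nonneg_def by blast
    then show ?thesis using k(2)[of j] k(2)[OF i] by linarith
  next
    case False
    then show ?thesis using k(2)[OF i] by linarith
  qed
  then show "\<exists>k\<in>E. \<forall>i\<in>E. \<bar>a i * x i\<bar> \<le> a k * x k" using k(1) by blast
next
  assume "\<exists>k\<in>E. \<forall>i\<in>E. \<bar>a i * x i\<bar> \<le> a k * x k"
  then show "weakly_nonneg E a x" unfolding weakly_nonneg_def by force
qed

text \<open>The larger of the two dominant terms survives, since the other vector is no larger at
  its index. A tie favours \<open>s\<close>, in accordance with \<open>left_sum\<close>.\<close>

lemma weakly_nonneg_left_sum:
  assumes E: "finite E" "E \<noteq> {}" and "weakly_nonneg E a s" "weakly_nonneg E a t"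
  shows "weakly_nonneg E a (left_sum s t)"
proof -
  obtain k1 k2 where k1: "k1 \<in> E" "\<And>i. i \<in> E \<Longrightarrow> \<bar>a i * s i\<bar> \<le> a k1 * s k1"
    and k2: "k2 \<in> E" "\<And>i. i \<in> E \<Longrightarrow> \<bar>a i * t i\<bar> \<le> a k2 * t k2"
    using assms weakly_nonneg_iff[OF E] by metis
  have le: "\<bar>a i * left_sum s t i\<bar> \<le> max (a k1 * s k1) (a k2 * t k2)" if "i \<in> E" for i
    using k1(2)[OF that] k2(2)[OF that] left_sum_pick[of s t i] by fastforce
  show ?thesis
  proof (cases "a k2 * t k2 \<le> a k1 * s k1")
    case True
    then have "\<bar>a k1\<bar> * \<bar>t k1\<bar> \<le> \<bar>a k1\<bar> * \<bar>s k1\<bar>"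
      using k2(2)[OF k1(1)] by (auto simp flip: abs_mult)
    then have "a k1 * left_sum s t k1 = a k1 * s k1"
      by (auto simp: left_sum_def mult_le_cancel_left)
    then show ?thesis using le True k1(1) weakly_nonneg_iff[OF E] by (metis max.absorb1)
  next
    case False
    then have "\<bar>a k2\<bar> * \<bar>s k2\<bar> < \<bar>a k2\<bar> * \<bar>t k2\<bar>"
      using k1(2)[OF k2(1)] by (auto simp flip: abs_mult)
    then have "left_sum s t k2 = t k2"
      by (auto simp: left_sum_def mult_less_cancel_left)
    then show ?thesis using le False k2(1) weakly_nonneg_iff[OF E] by (metis max.absorb2 linorder_le_cases)
  qed
qed

text \<open>A dominant term of \<open>s\<close> or \<open>t\<close> away from \<open>i\<close> stays
  dominant if it is at least \<open>\<bar>a i * v\<bar>\<close>. Otherwise the new term at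
  \<open>i\<close> is nonnegative and dominates.\<close>

lemma weakly_nonneg_segment:
  assumes E: "finite E" "i \<in> E" and "weakly_nonneg E a s" "weakly_nonneg E a t"
    and eq: "\<And>j. j \<in> E \<Longrightarrow> j \<noteq> i \<Longrightarrow> s j = t j" and v: "s i \<le> v" "v \<le> t i"
  shows "weakly_nonneg E a (s(i := v))"
proof -
  have E': "E \<noteq> {}" using E by blast
  obtain k1 k2 where k1: "k1 \<in> E" "\<And>i. i \<in> E \<Longrightarrow> \<bar>a i * s i\<bar> \<le> a k1 * s k1"
    and k2: "k2 \<in> E" "\<And>i. i \<in> E \<Longrightarrow> \<bar>a i * t i\<bar> \<le> a k2 * t k2"
    using assms weakly_nonneg_iff[OF E(1) E'] by metis
  have btw: "a i * s i \<le> a i * v \<and> a i * v \<le> a i * t i \<or> a i * t i \<le> a i * v \<and> a i * v \<le> a i * s i"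
    using v by (cases "a i \<ge> 0") (auto intro: mult_left_mono mult_left_mono_neg)
  let ?u = "s(i := v)"
  have *: ?thesis if "k \<in> E" "\<And>j. j \<in> E \<Longrightarrow> j \<noteq> i \<Longrightarrow> \<bar>a j * s j\<bar> \<le> a k * ?u k" "\<bar>a i * v\<bar> \<le> a k * ?u k" for k
  proof -
    have "\<bar>a j * ?u j\<bar> \<le> a k * ?u k" if "j \<in> E" for j
      using \<open>\<And>j. j \<in> E \<Longrightarrow> j \<noteq> i \<Longrightarrow> \<bar>a j * s j\<bar> \<le> a k * ?u k\<close> \<open>\<bar>a i * v\<bar> \<le> a k * ?u k\<close> that
      by (cases "j = i") auto
    then show ?thesis using that(1) weakly_nonneg_iff[OF E(1) E'] by blast
  qed
  consider "k1 \<noteq> i" "\<bar>a i * v\<bar> \<le> a k1 * s k1" | "k2 \<noteq> i" "\<bar>a i * v\<bar> \<le> a k2 * t k2"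
    | "k1 \<noteq> i \<longrightarrow> \<bar>a i * v\<bar> > a k1 * s k1" "k2 \<noteq> i \<longrightarrow> \<bar>a i * v\<bar> > a k2 * t k2" by force
  then show ?thesis
  proof cases
    case 1
    then show ?thesis using *[of k1] k1 by auto
  next
    case 2
    then show ?thesis using *[of k2] k2 eq by auto
  next
    case 3
    have pos: "0 \<le> a i * v" 
      using 3 btw k1(2)[OF E(2)] k2(2)[OF E(2)] by (cases "k1 = i"; cases "k2 = i") auto
    have "\<bar>a j * s j\<bar> \<le> a i * v" if j: "j \<in> E" "j \<noteq> i" for j
    proof -
      have "\<bar>a j * s j\<bar> \<le> a k1 * s k1" "\<bar>a j * s j\<bar> \<le> a k2 * t k2"
        using k1(2)[OF j(1)] k2(2)[OF j(1)] eq[OF j] by auto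
      then show ?thesis using 3 btw pos by (cases "k1 = i"; cases "k2 = i") auto
    qed
    then show ?thesis using *[of i] E(2) pos by auto
  qed
qed

section \<open>A theorem of the alternative in one orthant\<close>

text \<open>
  The weights are \<open>a i = 1 / R i\<close> with \<open>R i = Sup (D i)\<close>, except that \<open>R i\<close> is shrunk by a common
  factor \<open>\<rho> < 1\<close> wherever the supremum is not attained; this is what makes the inequality at \<open>j0\<close>
  strict. Unbounded \<open>D i\<close> force \<open>a i = 0\<close>.
\<close>

lemma cut_weights:
  fixes D :: "'i \<Rightarrow> real set"
  assumes E: "finite E" and X: "finite X"
    and down: "\<And>i r r'. r \<in> D i \<Longrightarrow> 0 \<le> r' \<Longrightarrow> r' \<le> r \<Longrightarrow> r' \<in> D i"
    and Z: "\<And>i. Z i > 0" "\<And>i. Z i \<in> D i"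
    and closure: "\<And>x i l. x \<in> X \<Longrightarrow> i \<in> E \<Longrightarrow> x i < 0 \<Longrightarrow> l > 0 \<Longrightarrow>
      (\<And>j. j \<in> E \<Longrightarrow> x j > 0 \<Longrightarrow> l * x j \<in> D j) \<Longrightarrow> l * - x i \<in> D i"
    and j0: "j0 \<in> E" "c > 0" "c \<notin> D j0"
  obtains a where "\<And>i. 0 \<le> a i" "\<And>x. x \<in> X \<Longrightarrow> weakly_nonneg E a x" "a j0 * c > 1"
    "\<And>i. i \<in> E \<Longrightarrow> a i * Z i \<le> 1"
proof -
  define R where "R i = Sup (D i)" for i
  define fin where "fin i \<longleftrightarrow> bdd_above (D i)" for i
  have R_upper: "r \<le> R i" if "fin i" "r \<in> D i" for r i
    using that unfolding R_def fin_def by (intro cSup_upper)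
  have R_below: "r \<in> D i" if "fin i" "r < R i" "0 \<le> r" for r i
  proof -
    from that(2) Z(2)[of i] obtain r' where "r' \<in> D i" "r < r'"
      unfolding R_def by (metis less_cSupD empty_iff)
    then show ?thesis using down that(3) by simp
  qed
  have inf: "r \<in> D i" if "\<not> fin i" "0 \<le> r" for r i
  proof -
    have "\<exists>r'\<in>D i. \<not> r' \<le> r" using that(1) unfolding fin_def bdd_above_def by blast
    then show ?thesis using down that(2) by (meson linorder_le_cases)
  qed
  have RZ: "Z i \<le> R i" if "fin i" for i using R_upper Z(2) that by blast
  have R0: "R i > 0" if "fin i" for i using RZ[OF that] Z(1)[of i] by linarith
  have lim: "((\<lambda>r. r * c) \<longlongrightarrow> c) (at_left 1)" for c :: real
    by (auto intro!: tendsto_eq_intros)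
  have "\<forall>\<^sub>F \<rho> in at_left 1. 0 < \<rho> \<and> \<rho> < 1 \<and> (\<forall>i\<in>E. Z i < R i \<longrightarrow> Z i < \<rho> * R i) \<and>
    (\<forall>x\<in>X. \<forall>i\<in>E. \<forall>j\<in>E. R j < R i / - x i * x j \<longrightarrow> R j < \<rho> * (R i / - x i * x j))"
  proof (intro eventually_conj eventually_ball_finite ballI E X)
    show "\<forall>\<^sub>F r in at_left 1. (0::real) < r"
      using order_tendstoD(1)[OF lim[of 1], of 0] by simp
    show "\<forall>\<^sub>F r in at_left 1. r < (1::real)"
      by (simp add: eventually_at_filter)
    show "\<forall>\<^sub>F \<rho> in at_left 1. Z i < R i \<longrightarrow> Z i < \<rho> * R i" for i
      using order_tendstoD(1)[OF lim[of "R i"], of "Z i"] by (cases "Z i < R i") auto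
    show "\<forall>\<^sub>F \<rho> in at_left 1. R j < R i / - x i * x j \<longrightarrow> R j < \<rho> * (R i / - x i * x j)" for x i j
      using order_tendstoD(1)[OF lim[of "R i / - x i * x j"], of "R j"]
      by (cases "R j < R i / - x i * x j") auto
  qed
  \<comment> \<open>\<open>\<rho>\<close> is so close to 1 that these finitely many strict
    inequalities survive multiplication by it.\<close>
  then obtain \<rho> where \<rho>: "0 < \<rho>" "\<rho> < 1" "\<And>i. i \<in> E \<Longrightarrow> Z i < R i \<Longrightarrow> Z i < \<rho> * R i"
    "\<And>x i j. x \<in> X \<Longrightarrow> i \<in> E \<Longrightarrow> j \<in> E \<Longrightarrow> R j < R i / - x i * x j \<Longrightarrow> R j < \<rho> * (R i / - x i * x j)"
    using eventually_happens'[OF trivial_limit_at_left_real, of _ "1::real"] by blast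
  define R' where "R' i = (if R i \<in> D i then R i else \<rho> * R i)" for i
  have R'0: "R' i > 0" if "fin i" for i using R0[OF that] \<rho>(1) by (simp add: R'_def)
  have R'R: "R' i \<le> R i" if "fin i" for i using R0[OF that] \<rho>(2) by (simp add: R'_def mult_le_cancel_right1)
  define a where "a i = (if fin i then 1 / R' i else 0)" for i
  have a0: "0 \<le> a i" for i using R'0[of i] by (simp add: a_def less_imp_le)
  have "weakly_nonneg E a x" if x: "x \<in> X" for x
  proof (rule ccontr)
    assume "\<not> weakly_nonneg E a x"
    then obtain i where i: "i \<in> E" "a i * x i < 0"
      and lt: "\<And>j. j \<in> E \<Longrightarrow> a j * x j < - (a i * x i)"
      unfolding weakly_nonneg_def by (metis linorder_not_le)
    have fi: "fin i" and xi: "x i < 0" using i a0[of i] by (auto simp: a_def mult_less_0_iff split: if_splits)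
    \<comment> \<open>At scale \<open>l\<close> the negative entry of \<open>x\<close> reaches
      exactly \<open>R' i\<close>, while the entry at every bounded \<open>D j\<close> stays
      strictly below \<open>R' j\<close>.\<close>
    define l where "l = R' i / - x i"
    have l0: "l > 0" using R'0[OF fi] xi by (simp add: l_def divide_pos_neg)
    have lR': "l * x j < R' j" if "j \<in> E" "fin j" for j
      using lt[OF that(1)] that(2) fi xi R'0[OF fi] R'0[OF that(2)]
      by (simp add: a_def l_def field_simps)
    show False
    proof (cases "R i \<in> D i")
      case True
      have "\<forall>\<^sub>F m in at_right l. l < m \<and> (\<forall>j\<in>E. fin j \<longrightarrow> m * x j < R j)"
      proof (intro eventually_conj eventually_ball_finite ballI E)
        show "\<forall>\<^sub>F m in at_right l. l < m" by (simp add: eventually_at_right_less)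
        show "\<forall>\<^sub>F m in at_right l. fin j \<longrightarrow> m * x j < R j" if "j \<in> E" for j
        proof (cases "fin j")
          case True
          then have "l * x j < R j" using lR'[OF that] R'R by fastforce
          moreover have "((\<lambda>m. m * x j) \<longlongrightarrow> l * x j) (at_right l)" by (auto intro!: tendsto_eq_intros)
          ultimately have "\<forall>\<^sub>F m in at_right l. m * x j < R j" by (rule order_tendstoD(2)[rotated])
          then show ?thesis by eventually_elim simp
        qed simp
      qed
      \<comment> \<open>The supremum is attained, so \<open>l\<close> can be enlarged a little;
        \<open>closure\<close> then gives an element of \<open>D i\<close> above
        \<open>R i\<close>.\<close>
      then obtain m where m: "l < m" "\<And>j. j \<in> E \<Longrightarrow> fin j \<Longrightarrow> m * x j < R j"
      using eventually_happens'[OF trivial_limit_at_right_real, of _ l] by blast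
      have "m * x j \<in> D j" if "j \<in> E" "x j > 0" for j
        using m l0 that R_below[of j "m * x j"] inf[of j "m * x j"] by (cases "fin j") auto
      then have "m * - x i \<in> D i" using closure[OF x i(1) xi, of m] m l0 by simp
      then have "m * - x i \<le> R i" using R_upper fi by blast
      moreover have "l * - x i = R i" using True xi by (simp add: l_def R'_def)
      moreover have "l * - x i < m * - x i" using m(1) xi by (intro mult_strict_right_mono) auto
      ultimately show False by linarith
    next
      case False
      \<comment> \<open>The supremum is not attained, and \<open>k * - x i = R i\<close>. The choice
        of \<open>\<rho>\<close> turns strict bounds at scale \<open>\<rho> * k\<close> into
        membership at scale \<open>k\<close>, so \<open>closure\<close> would put \<open>R i\<close>
        into \<open>D i\<close>.\<close>
      define k where "k = R i / - x i"
      have k0: "k > 0" using R0[OF fi] xi by (simp add: k_def divide_pos_neg)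
      have lk: "l = \<rho> * k" using False by (simp add: l_def k_def R'_def)
      have "k * x j \<in> D j" if j: "j \<in> E" "x j > 0" for j
      proof (cases "fin j")
        case True
        have "\<rho> * (k * x j) < R' j" using lR'[OF j(1) True] lk by (simp add: mult.assoc)
        show ?thesis
        proof (cases "R j \<in> D j")
          case T2: True
          then have "\<not> R j < k * x j"
            using \<rho>(4)[OF x i(1) j(1)] \<open>\<rho> * (k * x j) < R' j\<close> unfolding k_def by (auto simp: R'_def)
          then show ?thesis using down[OF T2] j k0 by simp
        next
          case F2: False
          then have "k * x j < R j" using \<open>\<rho> * (k * x j) < R' j\<close> \<rho>(1) by (simp add: R'_def)
          then show ?thesis using R_below True j k0 by simp
        qed
      qed (use inf j k0 in auto)
      then have "k * - x i \<in> D i" using closure[OF x i(1) xi k0] by simp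
      then show False using False xi by (simp add: k_def)
    qed
  qed
  moreover have "a j0 * c > 1"
  proof -
    have ub: "r \<le> c" if "r \<in> D j0" for r
      using down[OF that, of c] j0 by linarith
    then have fj: "fin j0" unfolding fin_def bdd_above_def by blast
    have Rj: "R j0 \<le> c" unfolding R_def using ub Z(2) by (intro cSup_least) auto
    have "R' j0 < c"
    proof (cases "R j0 \<in> D j0")
      case True
      then show ?thesis using Rj j0(3) by (auto simp: R'_def order_less_le)
    next
      case False
      then have "R' j0 < R j0" using \<rho>(2) R0[OF fj] by (simp add: R'_def)
      then show ?thesis using Rj by simp
    qed
    then show ?thesis using R'0[OF fj] fj by (simp add: a_def field_simps)
  qed
  moreover have "a i * Z i \<le> 1" if "i \<in> E" for i
  proof (cases "fin i")
    case True
    have "R i \<noteq> Z i" if "R i \<notin> D i" using Z(2)[of i] that by metis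
    then have "Z i \<le> R' i"
      using RZ[OF True] \<rho>(3)[OF \<open>i \<in> E\<close>] by (force simp: R'_def)
    then show ?thesis using R'0[OF True] True by (simp add: a_def field_simps)
  qed (simp add: a_def)
  ultimately show ?thesis using that a0 by blast
qed

text \<open>For each negative \<open>z j\<close> one seeks a vector of \<open>S\<close> at most
  \<open>z j\<close> at \<open>j\<close> and at most \<open>Z\<close> elsewhere. If all exist, their
  left sum works; a missing one yields a forbidden normal vector by
  \<open>cut_weights\<close>.\<close>

lemma orthant_alternative_nonzero:
  fixes S :: "('i \<Rightarrow> real) set"
  assumes E: "finite E" and S: "left_cone S" and X: "finite X" "X \<subseteq> S"
    and nz: "\<And>i. i \<in> E \<Longrightarrow> z i \<noteq> 0"
    and sep: "\<And>a. (\<And>i. 0 \<le> a i) \<Longrightarrow> (\<And>x. x \<in> X \<Longrightarrow> weakly_nonneg E a x) \<Longrightarrow> weakly_nonneg E a z"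
  shows "\<exists>s\<in>S. \<forall>i\<in>E. s i \<le> z i"
proof -
  have "\<exists>\<eta>>0. \<forall>i\<in>E. \<eta> < \<bar>z i\<bar>"
  proof -
    have "\<forall>\<^sub>F e in at_right 0. \<forall>i\<in>E. e < \<bar>z i\<bar>"
      using E nz by (intro eventually_ball_finite ballI eventually_at_right_less[THEN eventually_mono] order_tendstoD(2)[of _ 0]) (auto intro!: tendsto_eq_intros)
    moreover have "\<forall>\<^sub>F e in at_right 0. (0::real) < e" by (simp add: eventually_at_right_less)
    ultimately have "\<forall>\<^sub>F e in at_right 0. 0 < e \<and> (\<forall>i\<in>E. e < \<bar>z i\<bar>)" by eventually_elim auto
    then show ?thesis using eventually_happens by fastforce
  qed
  then obtain \<eta> where \<eta>: "\<eta> > 0" "\<And>i. i \<in> E \<Longrightarrow> \<eta> < \<bar>z i\<bar>" by blast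
  \<comment> \<open>At a negative coordinate an overshoot up to \<open>\<eta>\<close> is harmless:
    the vector chosen for that coordinate has larger absolute value there and wins the left
    sum.\<close>
  define Z where "Z i = (if z i > 0 then z i else \<eta>)" for i
  have Z0: "Z i > 0" for i using \<eta> by (simp add: Z_def)
  \<comment> \<open>The lower bounds \<open>r\<close> on \<open>1 / a i\<close> that hold, by a vector of \<open>S\<close>, whenever \<open>a k * Z k \<le> 1\<close> for all \<open>k\<close>.\<close>
  define D where "D i = {r. 0 \<le> r \<and> (r \<le> Z i \<or> (\<exists>s\<in>S. s i \<le> - r \<and> (\<forall>k\<in>E - {i}. s k \<le> Z k)))}" for i
  have D_down: "r' \<in> D i" if "r \<in> D i" "0 \<le> r'" "r' \<le> r" for r r' i
    using that unfolding D_def by force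
  have ZD: "Z i \<in> D i" for i using Z0[of i] by (simp add: D_def)
  have closure: "l * - x i \<in> D i"
    if x: "x \<in> X" and i: "i \<in> E" "x i < 0" and l: "l > 0"
      and pos: "\<And>j. j \<in> E \<Longrightarrow> x j > 0 \<Longrightarrow> l * x j \<in> D j" for x i l
  proof (cases "l * - x i \<le> Z i")
    case True
    then show ?thesis using i l by (auto simp: D_def mult_pos_neg less_imp_le)
  next
    case False
    define J where "J = {j \<in> E. x j > 0 \<and> l * x j > Z j}"
    have "\<forall>j\<in>J. \<exists>s. s \<in> S \<and> s j \<le> - (l * x j) \<and> (\<forall>k\<in>E - {j}. s k \<le> Z k)"
      using pos unfolding J_def D_def by fastforce
    from bchoice[OF this] obtain f where f: "\<And>j. j \<in> J \<Longrightarrow> f j \<in> S" "\<And>j. j \<in> J \<Longrightarrow> f j j \<le> - (l * x j)"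
      "\<And>j k. j \<in> J \<Longrightarrow> k \<in> E \<Longrightarrow> k \<noteq> j \<Longrightarrow> f j k \<le> Z k"
      by auto
    have "finite J" using E by (simp add: J_def)
    then obtain u where u: "u \<in> S" "\<And>i n. n \<in> J \<Longrightarrow> \<bar>f n i\<bar> \<le> \<bar>u i\<bar>"
      "\<And>i. u i = 0 \<or> (\<exists>n\<in>J. u i = f n i)"
      using left_cone_family[of S _ f, OF S _ f(1)] by blast
    \<comment> \<open>\<open>u\<close> stands on the left because at \<open>J\<close> it may merely
      tie with \<open>l * x\<close>. At \<open>i\<close>, as \<open>u i \<le> Z i\<close>, it can
      override \<open>l * x i\<close> only by being at least as negative.\<close>
    define s where "s = left_sum u (\<lambda>i. l * x i)"
    have "s \<in> S" using u(1) x X S l by (auto simp: s_def intro: left_cone_left_sum left_cone_scale)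
    have "u i \<le> Z i"
      using u(3)[of i] Z0[of i] f(3)[of _ i] i by (force simp: J_def)
    then have "s i \<le> - (l * - x i)"
      using False left_sum_pick[of u "\<lambda>i. l * x i" i] unfolding s_def by (auto simp: abs_if split: if_splits)
    moreover have "s k \<le> Z k" if k: "k \<in> E" "k \<noteq> i" for k
    proof -
      have "f n k \<le> Z k" if n: "n \<in> J" for n
      proof (cases "n = k")
        case True
        then have "f n k < 0" using f(2)[OF n] n l unfolding J_def by (smt (verit) mem_Collect_eq mult_pos_pos)
        then show ?thesis using Z0[of k] by simp
      qed (use f(3) n k in auto)
      then have uk: "u k \<le> Z k" using u(3)[of k] Z0[of k] by fastforce
      have "l * x k \<le> Z k" if less: "\<bar>u k\<bar> < \<bar>l * x k\<bar>"
      proof (rule ccontr)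
        assume "\<not> ?thesis"
        then have "l * x k > Z k" by simp
        then have "x k > 0" using Z0[of k] l by (metis less_trans zero_less_mult_pos)
        then have "k \<in> J" using \<open>l * x k > Z k\<close> k unfolding J_def by blast
        then show False using u(2)[OF \<open>k \<in> J\<close>, of k] f(2)[OF \<open>k \<in> J\<close>] less \<open>l * x k > Z k\<close> Z0[of k] by linarith
      qed
      then show ?thesis using uk left_sum_pick[of u "\<lambda>i. l * x i" k] unfolding s_def by auto
    qed
    ultimately have "\<exists>s\<in>S. s i \<le> - (l * - x i) \<and> (\<forall>k\<in>E - {i}. s k \<le> Z k)"
      using \<open>s \<in> S\<close> by blast
    then show ?thesis using i l by (auto simp: D_def mult_pos_neg less_imp_le)
  qed
  show ?thesis
  proof (cases "\<forall>j\<in>E. z j < 0 \<longrightarrow> - z j \<in> D j")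
    case True
    define N where "N = {j \<in> E. z j < 0}"
    have "\<forall>j\<in>N. \<exists>s. s \<in> S \<and> s j \<le> z j \<and> (\<forall>k\<in>E - {j}. s k \<le> Z k)"
      using True \<eta>(2) unfolding N_def D_def Z_def by force
    from bchoice[OF this] obtain f where f: "\<And>j. j \<in> N \<Longrightarrow> f j \<in> S" "\<And>j. j \<in> N \<Longrightarrow> f j j \<le> z j"
      "\<And>j k. j \<in> N \<Longrightarrow> k \<in> E \<Longrightarrow> k \<noteq> j \<Longrightarrow> f j k \<le> Z k"
      by auto
    have "finite N" using E by (simp add: N_def)
    then obtain u where u: "u \<in> S" "\<And>i n. n \<in> N \<Longrightarrow> \<bar>f n i\<bar> \<le> \<bar>u i\<bar>"
      "\<And>i. u i = 0 \<or> (\<exists>n\<in>N. u i = f n i)"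
      using left_cone_family[of S _ f, OF S _ f(1)] by blast
    have "u i \<le> z i" if i: "i \<in> E" for i
    proof (cases "z i < 0")
      case True
      then have iN: "i \<in> N" using i by (simp add: N_def)
      have big: "\<bar>u i\<bar> \<ge> - z i" using u(2)[OF iN, of i] f(2)[OF iN] True by linarith
      then obtain n where n: "n \<in> N" "u i = f n i" using u(3)[of i] True by auto
      show ?thesis
      proof (cases "n = i")
        case False
        then have "u i \<le> \<eta>" using f(3)[OF n(1) i] n True by (auto simp: Z_def)
        then show ?thesis using big \<eta>(2)[OF i] True by linarith
      qed (use n f(2) in auto)
    next
      case False
      then have zi: "z i > 0" "Z i = z i" using nz[OF i] by (auto simp: Z_def)
      have "f n i \<le> z i" if "n \<in> N" for n
      proof -
        have "i \<noteq> n" using zi that by (auto simp: N_def)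
        then show ?thesis using f(3)[OF that i] zi by simp
      qed
      then show ?thesis using u(3)[of i] zi by auto
    qed
    then show ?thesis using u(1) by blast
  next
    case False
    then obtain j0 where j0: "j0 \<in> E" "z j0 < 0" "- z j0 \<notin> D j0" by blast
    \<comment> \<open>The negative term of \<open>z\<close> at \<open>j0\<close> exceeds 1 in size,
      whereas positive terms are at most 1, so \<open>z\<close> violates a halfspace satisfied by
      \<open>X\<close>.\<close>
    obtain a where a: "\<And>i. 0 \<le> a i" "\<And>x. x \<in> X \<Longrightarrow> weakly_nonneg E a x" "a j0 * - z j0 > 1"
      "\<And>i. i \<in> E \<Longrightarrow> a i * Z i \<le> 1"
      by (rule cut_weights[of E X D Z j0 "- z j0"]) (use E X D_down Z0 ZD closure j0 in auto)
    then have "weakly_nonneg E a z" using sep by blast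
    moreover have "a j0 * z j0 < 0" using a(3) by simp
    ultimately obtain k where k: "k \<in> E" "- (a j0 * z j0) \<le> a k * z k"
      using j0(1) unfolding weakly_nonneg_def by blast
    then have gt: "a k * z k > 1" using a(3) by simp
    then have "z k > 0" using a(1)[of k] by (smt (verit) mult_nonneg_nonpos)
    then show ?thesis using a(4)[OF k(1)] gt by (simp add: Z_def)
  qed
qed

text \<open>Fourier--Motzkin elimination: an upper bound on \<open>a n\<close> (from \<open>y\<close>) and a lower bound (from \<open>x\<close>) are
  compatible because of the left sum in which the negative entry of \<open>y\<close> at \<open>n\<close> wins the tie.\<close>

lemma eliminate_coordinate:
  fixes X :: "('i \<Rightarrow> real) set"
  assumes E: "finite E" and X: "finite X" and n: "n \<in> E" and a: "\<And>i. 0 \<le> a i"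
    and X0: "\<And>x. x \<in> X \<Longrightarrow> x n \<le> 0 \<Longrightarrow> weakly_nonneg (E - {n}) a x"
    and Xc: "\<And>x y. x \<in> X \<Longrightarrow> 0 < x n \<Longrightarrow> y \<in> X \<Longrightarrow> y n < 0 \<Longrightarrow> 
      weakly_nonneg (E - {n}) a (left_sum y (\<lambda>i. (- y n / x n) * x i))"
  obtains t where "0 \<le> t" "\<And>x. x \<in> X \<Longrightarrow> weakly_nonneg E (a(n := t)) x"
proof -
  \<comment> \<open>At a bad pair only the term at \<open>n\<close> can outweigh the negative term
    at \<open>i\<close>, which is a lower bound on the weight at \<open>n\<close>; \<open>t\<close>
    is the least nonnegative weight meeting all these bounds.\<close>
  define Bad where "Bad = {(x, i). (x, i) \<in> X \<times> (E - {n}) \<and> 0 < x n \<and> a i * x i < 0 \<and>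
    (\<forall>j\<in>E - {n}. a j * x j < - (a i * x i))}"
  define T where "T = insert 0 ((\<lambda>(x, i). - (a i * x i) / x n) ` Bad)"
  have "finite Bad"
    by (rule finite_subset[of _ "X \<times> (E - {n})"]) (use E X in \<open>auto simp: Bad_def\<close>)
  then have fT: "finite T" by (simp add: T_def)
  define t where "t = Max T"
  have t0: "0 \<le> t" unfolding t_def using fT by (intro Max_ge) (auto simp: T_def)
  have tT: "t \<in> T" unfolding t_def using fT by (intro Max_in) (auto simp: T_def)
  have "weakly_nonneg E (a(n := t)) x" if x: "x \<in> X" for x
    unfolding weakly_nonneg_def
  proof (intro ballI impI)
    fix i assume i: "i \<in> E" "(a(n := t)) i * x i < 0"
    let ?G = "\<exists>j\<in>E. - ((a(n := t)) i * x i) \<le> (a(n := t)) j * x j"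
    have G: ?G if j: "j \<in> E - {n}" "- ((a(n := t)) i * x i) \<le> a j * x j" for j
      using j by (intro bexI[of _ j]) auto
    show ?G
    proof (cases "i = n")
      case False
      then have i': "i \<in> E - {n}" "a i * x i < 0" using i by auto
      show ?thesis
      proof (cases "\<exists>j\<in>E - {n}. - (a i * x i) \<le> a j * x j")
        case True
        then show ?thesis using G False by auto
      next
        case none: False
        then have xn: "0 < x n" using X0[OF x] i' unfolding weakly_nonneg_def by (meson linorder_not_le)
        then have "(x, i) \<in> Bad" using none x i' by (auto simp: Bad_def not_le)
        then have "- (a i * x i) / x n \<in> T" unfolding T_def by (intro insertI2 image_eqI[of _ _ "(x, i)"]) auto
        then have "- (a i * x i) / x n \<le> t"
          unfolding t_def using fT by (intro Max_ge)
        then show ?thesis using xn False n by (intro bexI[of _ n]) (auto simp: field_simps)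
      qed
    next
      case True
      then have tx: "t * x n < 0" using i by simp
      then have tp: "t > 0" and xn: "x n < 0" using t0 by (auto simp: mult_less_0_iff)
      then obtain w k where wk: "(w, k) \<in> Bad" "t = - (a k * w k) / w n"
        using tT unfolding T_def by auto
      then have w: "w \<in> X" "0 < w n" "k \<in> E - {n}" "a k * w k < 0"
        "\<And>j. j \<in> E - {n} \<Longrightarrow> a j * w j < - (a k * w k)" by (auto simp: Bad_def)
      \<comment> \<open>Then \<open>c * w n = - x n\<close>, so the left sum \<open>v\<close> keeps
        the entry of \<open>x\<close> at \<open>n\<close>, and the bad term of \<open>w\<close> at
        \<open>k\<close> becomes \<open>t * x n = - \<tau>\<close>.\<close>
      define c where "c = - x n / w n"
      have c: "c > 0" using xn w(2) by (simp add: c_def divide_neg_pos)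
      define \<tau> where "\<tau> = - (t * x n)"
      have \<tau>: "\<tau> > 0" "a k * (c * w k) = - \<tau>" using tx w(2) by (simp_all add: \<tau>_def c_def wk(2))
      define v where v: "v = left_sum x (\<lambda>i. c * w i)"
      have wv: "weakly_nonneg (E - {n}) a v" using Xc[OF w(1,2) x xn] by (simp add: v c_def)
      show ?thesis
      proof (cases "\<exists>j\<in>E - {n}. \<tau> \<le> a j * x j")
        case True
        then show ?thesis using G \<open>i = n\<close> by (auto simp: \<tau>_def)
      next
        case False
        then have lx: "\<And>j. j \<in> E - {n} \<Longrightarrow> a j * x j < \<tau>" by force
        have lw: "a j * (c * w j) < \<tau>" if "j \<in> E - {n}" for j
          using mult_strict_left_mono[OF w(5)[OF that] c] \<tau>(2) by (simp add: mult_ac)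
        \<comment> \<open>Hence \<open>v\<close> takes the entry of \<open>c * w\<close> at
          \<open>k\<close>; it then has the term \<open>- \<tau>\<close> but none reaching
          \<open>\<tau>\<close>, contrary to \<open>wv\<close>.\<close>
        have "- \<tau> < a k * x k"
        proof (cases "a k * x k < 0")
          case True
          then show ?thesis using X0[OF x] xn w(3) lx unfolding weakly_nonneg_def by fastforce
        qed (use \<tau> in auto)
        then have "\<bar>a k * x k\<bar> < \<bar>a k * (c * w k)\<bar>" using lx[OF w(3)] \<tau> by (auto simp: abs_if)
        then have "\<bar>x k\<bar> < \<bar>c * w k\<bar>" by (auto simp: abs_mult mult_less_cancel_left)
        then have "a k * v k = - \<tau>" using \<tau>(2) by (simp add: v left_sum_def)
        then obtain j where j: "j \<in> E - {n}" "\<tau> \<le> a j * v j"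
          using wv w(3) \<tau>(1) unfolding weakly_nonneg_def by force
        then show ?thesis using lx lw left_sum_pick[of x "\<lambda>i. c * w i" j] by (fastforce simp: v)
      qed
    qed
  qed
  then show ?thesis using that t0 by blast
qed

section \<open>Induction over the coordinates where \<open>z\<close> vanishes\<close>

lemma left_cone_halfspace:
  assumes "left_cone S"
  shows "left_cone {s \<in> S. 0 \<le> \<tau> * s n}"
  unfolding left_cone_def
proof (intro conjI ballI allI impI; clarsimp?)
  show "(\<lambda>_. 0) \<in> S" using assms by (rule left_cone_zero)
next
  fix c :: real and s assume "0 < c" "s \<in> S" "0 \<le> \<tau> * s n"
  then show "(\<lambda>i. c * s i) \<in> S \<and> 0 \<le> \<tau> * (c * s n)"
    using left_cone_scale[OF assms] mult_nonneg_nonneg[of c "\<tau> * s n"] by (simp add: mult.left_commute)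
next
  fix s t assume "s \<in> S" "0 \<le> \<tau> * s n" "t \<in> S" "0 \<le> \<tau> * t n"
  then show "left_sum s t \<in> S \<and> 0 \<le> \<tau> * left_sum s t n"
    using left_cone_left_sum[OF assms] by (simp add: left_sum_def)
qed

text \<open>Where \<open>z n = 0\<close>, the demand \<open>s n \<le> 0\<close> is built into the
  cone and \<open>X\<close> is replaced by its eliminations, so that \<open>n\<close> can be
  forgotten.\<close>

lemma orthant_alternative:
  fixes S :: "('i \<Rightarrow> real) set"
  assumes E: "finite E" and S: "left_cone S" and X: "finite X" "X \<subseteq> S"
    and sep: "\<And>a. (\<And>i. 0 \<le> a i) \<Longrightarrow> (\<And>x. x \<in> X \<Longrightarrow> weakly_nonneg E a x) \<Longrightarrow> weakly_nonneg E a z"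
  shows "\<exists>s\<in>S. \<forall>i\<in>E. s i \<le> z i"
  using E S X sep
proof (induction E arbitrary: S X rule: finite_psubset_induct)
  case (psubset E)
  show ?case
  proof (cases "\<forall>i\<in>E. z i \<noteq> 0")
    case True
    then show ?thesis
      using psubset.prems by (intro orthant_alternative_nonzero[OF psubset.hyps psubset.prems(1-3)]) auto
  next
    case False
    then obtain n where n: "n \<in> E" "z n = 0" by blast
    let ?E = "E - {n}" and ?S = "{s \<in> S. 0 \<le> (- 1) * s n}"
    define P where "P = {x \<in> X. 0 < x n}"
    define N where "N = {x \<in> X. x n < 0}"
    \<comment> \<open>The factor makes the entries at \<open>n\<close> opposite; with
      \<open>y\<close> on the left the negative one wins, so the combination stays in
      \<open>?S\<close>.\<close>
    define comb where "comb \<equiv> \<lambda>(y, x). left_sum y (\<lambda>i. (- y n / x n) * x i)"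
    define X' where "X' = {x \<in> X. x n \<le> 0} \<union> comb ` (N \<times> P)"
    have sub: "?E \<subset> E" using n(1) by auto
    have "\<exists>s\<in>?S. \<forall>i\<in>?E. s i \<le> z i"
    proof (rule psubset.IH[OF sub])
      show "left_cone ?S" using left_cone_halfspace[OF psubset.prems(1)] .
      show "finite X'" using psubset.prems(2) by (simp add: X'_def N_def P_def)
      have "comb (y, x) \<in> S \<and> comb (y, x) n \<le> 0" if "y \<in> N" "x \<in> P" for x y
      proof -
        have yx: "y \<in> S" "y n < 0" "x \<in> S" "x n > 0" using that psubset.prems(3) by (auto simp: N_def P_def)
        have "(\<lambda>i. - y n / x n * x i) \<in> S"
          using yx by (intro left_cone_scale[OF psubset.prems(1)]) (auto simp: divide_neg_pos)
        then have "comb (y, x) \<in> S"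
          unfolding comb_def using left_cone_left_sum[OF psubset.prems(1) yx(1)] by simp
        moreover have "comb (y, x) n = y n" using yx by (simp add: comb_def left_sum_def abs_mult)
        ultimately show ?thesis using yx(2) by simp
      qed
      then show "X' \<subseteq> ?S" using psubset.prems(3) by (auto simp: X'_def)
      fix a :: "'i \<Rightarrow> real"
      assume a: "\<And>i. 0 \<le> a i" and w: "\<And>x. x \<in> X' \<Longrightarrow> weakly_nonneg ?E a x"
      obtain t where t: "0 \<le> t" "\<And>x. x \<in> X \<Longrightarrow> weakly_nonneg E (a(n := t)) x"
      proof (rule eliminate_coordinate[of E X n a])
        show "weakly_nonneg ?E a x" if "x \<in> X" "x n \<le> 0" for x using w that by (simp add: X'_def)
        show "weakly_nonneg ?E a (left_sum y (\<lambda>i. - y n / x n * x i))"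
          if xy: "x \<in> X" "0 < x n" "y \<in> X" "y n < 0" for x y
        proof -
          have "comb (y, x) \<in> X'" using xy by (auto simp: X'_def N_def P_def)
          from w[OF this] show ?thesis by (simp add: comb_def)
        qed
      qed (use psubset n a in auto)
      have "weakly_nonneg E (a(n := t)) z"
      proof (rule psubset.prems(4))
        show "0 \<le> (a(n := t)) i" for i using a t(1) by simp
      qed (rule t(2))
      then show "weakly_nonneg ?E a z"
        using n by (fastforce simp: weakly_nonneg_def split: if_splits)
    qed
    then show ?thesis using n by (metis (no_types, lifting) Diff_iff mem_Collect_eq mult_minus1 neg_0_le_iff_le singletonD)
  qed
qed

section \<open>Merging the orthants\<close>

text \<open>Case split for a segment from \<open>p\<close> to \<open>q\<close>: values on the side
  of \<open>q\<close> of size at least \<open>\<bar>p\<bar>\<close> come from rescaling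
  \<open>q\<close>, all others lie between \<open>p\<close> and \<open>- p\<close>.\<close>

lemma between_opposite:
  fixes p q v :: real
  assumes "\<bar>p\<bar> \<le> \<bar>q\<bar>" "q \<noteq> 0" "p \<le> v \<and> v \<le> q \<or> q \<le> v \<and> v \<le> p"
    and "\<not> (0 \<le> v * q \<and> \<bar>p\<bar> \<le> \<bar>v\<bar>)"
  shows "p * q < 0 \<and> \<bar>v\<bar> \<le> \<bar>p\<bar>"
proof (cases "q > 0")
  case True
  then have "0 \<le> v * q \<longleftrightarrow> 0 \<le> v" "p * q < 0 \<longleftrightarrow> p < 0"
    by (simp_all add: zero_le_mult_iff mult_less_0_iff)
  then show ?thesis using assms True by linarith
next
  case False
  then have "0 \<le> v * q \<longleftrightarrow> v \<le> 0" "p * q < 0 \<longleftrightarrow> 0 < p"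
    using assms(2) by (auto simp: zero_le_mult_iff mult_less_0_iff)
  then show ?thesis using assms False by linarith
qed

text \<open>Axis-parallel segments survive the projection forgetting coordinate \<open>n\<close>, provided \<open>n\<close> has constant
  sign: then the two left sums of suitable multiples agree at \<open>n\<close>.\<close>

lemma tc_cone_segment_drop:
  assumes S: "tc_cone E S" and ni: "n \<in> E" "i \<in> E" "i \<noteq> n" and \<tau>: "\<tau> \<noteq> 0"
    and st: "s \<in> S" "t \<in> S" "0 \<le> \<tau> * s n" "0 \<le> \<tau> * t n"
    and eq: "\<And>j. j \<in> E - {n} - {i} \<Longrightarrow> s j = t j" and le: "\<bar>s i\<bar> \<le> \<bar>t i\<bar>"
    and v: "s i \<le> v \<and> v \<le> t i \<or> t i \<le> v \<and> v \<le> s i"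
  shows "\<exists>u\<in>S. 0 \<le> \<tau> * u n \<and> (\<forall>j\<in>E - {n} - {i}. u j = s j) \<and> u i = v"
proof (cases "v = s i")
  case True
  then show ?thesis using st by blast
next
  case False
  then have ti: "t i \<noteq> 0" using le v by auto
  have scaled: "left_sum (\<lambda>j. l * t j) s j = s j" "left_sum s (\<lambda>j. l * t j) j = s j"
    if j: "j \<in> E - {n} - {i}" and l: "0 < l" "l \<le> 1" for l j
  proof -
    have "\<bar>l * s j\<bar> \<le> \<bar>s j\<bar>" "\<bar>s j\<bar> \<le> \<bar>l * s j\<bar> \<Longrightarrow> l * s j = s j"
      using l by (auto simp: abs_mult mult_le_cancel_right1 mult_le_cancel_right2)
    then show "left_sum (\<lambda>j. l * t j) s j = s j" "left_sum s (\<lambda>j. l * t j) j = s j"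
      using eq[OF j] by (auto simp: left_sum_def)
  qed
  have halfspace: "0 \<le> \<tau> * left_sum p q n" if "0 \<le> \<tau> * p n" "0 \<le> \<tau> * q n" for p q
    using that by (simp add: left_sum_def)
  have lt: "(\<lambda>j. l * t j) \<in> S" "0 \<le> \<tau> * (l * t n)" if "0 < l" for l
    using left_cone_scale[OF tc_cone_left_cone[OF S] that st(2)] st(4) that mult_nonneg_nonneg[of l "\<tau> * t n"] by (simp_all add: mult.left_commute)
  show ?thesis
  proof (cases "0 \<le> v * t i \<and> \<bar>s i\<bar> \<le> \<bar>v\<bar>")
    case True
    have v0: "v \<noteq> 0" using True False by auto
    \<comment> \<open>The scaled \<open>t\<close> has entry \<open>v\<close> at \<open>i\<close>; as
      \<open>l \<le> 1\<close>, the left sum with \<open>s\<close> restores the other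
      entries.\<close>
    define l where "l = v / t i"
    have "\<bar>v\<bar> \<le> \<bar>t i\<bar>" using v le by linarith
    then have l: "0 < l" "l \<le> 1" "l * t i = v"
      using True v0 ti unfolding l_def
      by (auto simp: zero_less_divide_iff zero_le_mult_iff divide_le_eq_1)
    show ?thesis
    proof (intro bexI conjI ballI)
      show "left_sum (\<lambda>j. l * t j) s \<in> S"
        by (rule left_cone_left_sum[OF tc_cone_left_cone[OF S] lt(1)[OF l(1)] st(1)])
      show "0 \<le> \<tau> * left_sum (\<lambda>j. l * t j) s n" by (rule halfspace) (use lt(2)[OF l(1)] st(3) in auto)
      show "left_sum (\<lambda>j. l * t j) s j = s j" if "j \<in> E - {n} - {i}" for j
        using scaled(1)[OF that] l by blast
      show "left_sum (\<lambda>j. l * t j) s i = v" using l(3) True by (simp add: left_sum_def)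
    qed
  next
    case F2: False
    have opp: "s i * t i < 0" "\<bar>v\<bar> \<le> \<bar>s i\<bar>"
      using between_opposite[OF le ti v F2] by blast+
    \<comment> \<open>The scaled \<open>t\<close> ties with \<open>s\<close> at \<open>i\<close>
      with opposite sign: the two orders of the left sum give \<open>s i\<close> and
      \<open>- s i\<close> there and agree elsewhere on \<open>E\<close>.\<close>
    define l where "l = - s i / t i"
    have l: "0 < l" "l \<le> 1" "l * t i = - s i"
      using opp(1) le unfolding l_def
      by (cases "t i > 0"; force simp: field_simps mult_less_0_iff abs_if)+
    let ?p = "left_sum s (\<lambda>j. l * t j)" and ?q = "left_sum (\<lambda>j. l * t j) s"
    have pq: "?p \<in> S" "?q \<in> S" "?p i = s i" "?q i = - s i"
      using left_cone_left_sum[OF tc_cone_left_cone[OF S]] lt(1)[OF l(1)] st(1) l(3) by (auto simp: left_sum_def)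
    have same_sign: "0 \<le> p \<and> 0 \<le> q \<or> p \<le> 0 \<and> q \<le> 0" if "0 \<le> \<tau> * p" "0 \<le> \<tau> * q" for p q
      using that \<tau> by (auto simp: zero_le_mult_iff)
    have "?p n = ?q n"
      using same_sign[OF st(3) lt(2)[OF l(1)]] by (auto simp: left_sum_def)
    then have agree: "?p j = ?q j" if "j \<in> E" "j \<noteq> i" for j
      using scaled[of j l] l that by (cases "j = n") auto
    have between: "?p i \<le> v \<and> v \<le> ?q i \<or> ?q i \<le> v \<and> v \<le> ?p i"
      unfolding pq(3,4) using opp(2) by linarith
    obtain u where u: "u \<in> S" "\<And>j. j \<in> E \<Longrightarrow> j \<noteq> i \<Longrightarrow> u j = ?p j" "u i = v"
      using tc_cone_segment[OF S pq(1,2) ni(2) agree between] by blast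
    have "0 \<le> \<tau> * ?p n" by (rule halfspace) (use lt(2)[OF l(1)] st(3) in auto)
    then have "0 \<le> \<tau> * u n" using u(2)[of n] ni by simp
    moreover have "u j = s j" if "j \<in> E - {n} - {i}" for j
      using u(2)[of j] scaled(2)[OF that l(1,2)] that by simp
    ultimately show ?thesis using u(1,3) by blast
  qed
qed

lemma tc_cone_drop:
  assumes S: "tc_cone E S" and n: "n \<in> E" and \<tau>: "\<tau> \<noteq> 0"
  shows "tc_cone (E - {n}) {s \<in> S. 0 \<le> \<tau> * s n}"
  unfolding tc_cone_def
proof (intro conjI ballI allI impI)
  show "left_cone {s \<in> S. 0 \<le> \<tau> * s n}" using left_cone_halfspace[OF tc_cone_left_cone[OF S]] .
  fix s t i v
  assume s: "s \<in> {s \<in> S. 0 \<le> \<tau> * s n}" and t: "t \<in> {s \<in> S. 0 \<le> \<tau> * s n}" and i: "i \<in> E - {n}"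
    and eq: "\<forall>j\<in>E - {n} - {i}. s j = t j" and v: "s i \<le> v" "v \<le> t i"
  have "\<exists>u\<in>S. 0 \<le> \<tau> * u n \<and> (\<forall>j\<in>E - {n} - {i}. u j = s j) \<and> u i = v"
  proof (cases "\<bar>s i\<bar> \<le> \<bar>t i\<bar>")
    case True
    show ?thesis by (rule tc_cone_segment_drop[OF S n _ _ \<tau>, of i s t]) (use s t i eq v True in auto)
  next
    case False
    have "\<exists>u\<in>S. 0 \<le> \<tau> * u n \<and> (\<forall>j\<in>E - {n} - {i}. u j = t j) \<and> u i = v"
      by (rule tc_cone_segment_drop[OF S n _ _ \<tau>, of i t s]) (use s t i eq v False in auto)
    then show ?thesis using eq by metis
  qed
  then show "\<exists>u\<in>{s \<in> S. 0 \<le> \<tau> * s n}. (\<forall>j\<in>E - {n} - {i}. u j = s j) \<and> u i = v" by blast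
qed

text \<open>
  Let \<open>D'\<close> be the coordinates where the scaled vector \<open>y\<close> is below \<open>- 1\<close>. Left sums of \<open>U m\<close>, \<open>y\<close> and
  multiples of the \<open>U n\<close>, in various orders, realise all corners of the box
  \<open>\<Prod>n\<in>D'. [y n, - y n]\<close>, with entry \<open>1\<close> in the other coordinates and a common entry at \<open>m\<close>;
  filling the box along the axes reaches \<open>1\<close> in all coordinates but \<open>m\<close>.
\<close>

lemma orthants_merge_corners:
  fixes s :: "'i \<Rightarrow> real"
  assumes E: "finite E" and S: "tc_cone E S" and m: "m \<in> E"
    and U: "\<And>n. n \<in> E \<Longrightarrow> U n \<in> S" "\<And>n i. n \<in> E \<Longrightarrow> i \<in> E \<Longrightarrow> i \<noteq> n \<Longrightarrow> U n i = 1"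
    and Um: "0 \<le> U m m" "U m m < 1" and Un: "\<And>n. n \<in> E \<Longrightarrow> n \<noteq> m \<Longrightarrow> 1 < U n n"
    and s: "s \<in> S" "\<And>i. i \<in> E \<Longrightarrow> i \<noteq> m \<Longrightarrow> s i \<le> 1" "1 \<le> s m"
  shows "\<exists>u\<in>S. \<forall>i\<in>E. u i = 1"
proof -
  note cone = tc_cone_left_cone[OF S]
  define D where "D = {n \<in> E - {m}. s n < - 1}"
  \<comment> \<open>\<open>k\<close> is the largest factor at most 1 such that
    \<open>k * s n\<close> is at most \<open>U n n\<close> in size for all \<open>n\<close> in
    \<open>D\<close>; this makes the factors \<open>l n\<close> at most 1.\<close>
  define K where "K = insert 1 ((\<lambda>n. U n n / - s n) ` D)"
  define k where "k = Min K"
  have fK: "finite K" "K \<noteq> {}" using E by (auto simp: K_def D_def)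
  have k1: "k \<le> 1" using fK(1) unfolding k_def K_def by (intro Min_le) auto
  have kD: "k \<le> U n n / - s n" if "n \<in> D" for n
    using fK(1) that unfolding k_def K_def by (intro Min_le) auto
  have kK: "k \<in> K" unfolding k_def using fK by (intro Min_in)
  have "0 < U n n / - s n" if "n \<in> D" for n
    using Un[of n] that by (intro divide_pos_pos) (auto simp: D_def)
  then have k0: "k > 0" using kK unfolding K_def by auto
  define y where "y = (\<lambda>i. k * s i)"
  have y: "y \<in> S" unfolding y_def using left_cone_scale[OF cone k0 s(1)] .
  have y1: "y i \<le> 1" if "i \<in> E" "i \<noteq> m" for i
  proof -
    have "k * s i \<le> k * 1" using s(2)[OF that] k0 by (intro mult_left_mono) auto
    then show ?thesis using k1 by (simp add: y_def)
  qed
  have ym: "y m > 0" using s(3) k0 by (simp add: y_def)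
  define D' where "D' = {n \<in> E - {m}. y n < - 1}"
  have D'D: "n \<in> D" if "n \<in> D'" for n
  proof -
    have "k * s n < 0" using that by (simp add: D'_def y_def)
    then have "s n < 0" using k0 by (simp add: mult_less_0_iff)
    then have "s n \<le> k * s n" using k1 by (simp add: mult_le_cancel_right1)
    then show ?thesis using that by (auto simp: D_def D'_def y_def)
  qed
  have fD': "finite D'" using E by (simp add: D'_def)
  define l where "l n = - y n / U n n" for n
  have Un0: "U n n > 0" if "n \<in> D'" for n using Un[of n] that by (auto simp: D'_def)
  have l: "0 < l n" "l n \<le> 1" "l n * U n n = - y n" if "n \<in> D'" for n
  proof -
    have yn: "y n < - 1" using that by (simp add: D'_def)
    show "0 < l n" "l n * U n n = - y n" using Un0[OF that] yn by (simp_all add: l_def divide_neg_pos)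
    have "s n < 0" using D'D[OF that] by (simp add: D_def)
    then have "- y n \<le> U n n" using kD[OF D'D[OF that]] by (simp add: y_def field_simps)
    then show "l n \<le> 1" using Un0[OF that] by (simp add: l_def field_simps)
  qed
  define G where "G n = (\<lambda>i. l n * U n i)" for n
  have G: "G n \<in> S" "G n n = - y n" "\<And>i. i \<in> E \<Longrightarrow> i \<noteq> n \<Longrightarrow> G n i = l n" if "n \<in> D'" for n
    using that left_cone_scale[OF cone l(1) U(1)] l(3)[OF that] U(2) by (auto simp: G_def D'_def)
  have corner: "\<exists>u\<in>S. u m = max 1 (y m) \<and> (\<forall>i\<in>E - {m}.
      u i = (if i \<in> T then - y i else if i \<in> D' then y i else 1))" if T: "T \<subseteq> D'" for T
  proof -
    have fT: "finite T" using fD' T finite_subset by blast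
    have GS: "\<And>n. n \<in> T \<Longrightarrow> G n \<in> S" using G(1) T by blast
    obtain A0 where A0: "A0 \<in> S" "\<And>i n. n \<in> T \<Longrightarrow> \<bar>G n i\<bar> \<le> \<bar>A0 i\<bar>"
      "\<And>i. A0 i = 0 \<or> (\<exists>n\<in>T. A0 i = G n i)"
      using left_cone_family[of S T G, OF cone fT GS] by blast
    \<comment> \<open>Outside \<open>T\<close> the entries of \<open>A0\<close> lie in
      \<open>[0, 1]\<close>, so \<open>U m\<close> restores 1 away from \<open>m\<close>; on
      \<open>T\<close> the entries \<open>- y i\<close> exceed 1 and survive.\<close>
    define A where "A = left_sum (U m) A0"
    have AS: "A \<in> S" unfolding A_def using left_cone_left_sum[OF cone U(1)[OF m] A0(1)] .
    have A0_01: "0 \<le> A0 i \<and> A0 i \<le> 1" if "i \<in> E" "i \<notin> T" for i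
    proof -
      have "G n i = l n \<and> 0 < l n \<and> l n \<le> 1" if "n \<in> T" for n
        using that \<open>i \<in> E\<close> \<open>i \<notin> T\<close> G(3)[of n i] l(1,2)[of n] T by auto
      then show ?thesis using A0(3)[of i] by force
    qed
    have A_T: "A i = - y i" if i: "i \<in> T" for i
    proof -
      have iD: "i \<in> D'" using i T by blast
      have yi: "y i < - 1" and iE: "i \<in> E" "i \<noteq> m" using iD by (auto simp: D'_def)
      have big: "\<bar>A0 i\<bar> > 1" using A0(2)[OF i, of i] G(2)[OF iD] yi by linarith
      then obtain n where n: "n \<in> T" "A0 i = G n i" using A0(3)[of i] by auto
      have "n = i"
      proof (rule ccontr)
        assume "n \<noteq> i"
        then have "G n i = l n" "0 < l n" "l n \<le> 1" using G(3)[of n i] l(1,2)[of n] n(1) T iE by auto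
        then show False using n big by simp
      qed
      then show ?thesis using n G(2)[OF iD] big U(2)[OF m iE] by (simp add: A_def left_sum_def)
    qed
    have A_1: "A i = 1" if "i \<in> E" "i \<noteq> m" "i \<notin> T" for i
      using A0_01[OF that(1,3)] U(2)[OF m that(1,2)] by (simp add: A_def left_sum_def)
    have mT: "m \<notin> T" using T by (auto simp: D'_def)
    have A_m: "0 \<le> A m" "A m \<le> 1" using A0_01[OF m mT] Um by (auto simp: A_def left_sum_def)
    \<comment> \<open>On \<open>T\<close> the sizes tie and \<open>A\<close> wins; on the rest of
      \<open>D'\<close> the entry of \<open>y\<close> is larger.\<close>
    define B where "B = left_sum A y"
    have BS: "B \<in> S" unfolding B_def using left_cone_left_sum[OF cone AS y] .
    have B: "B i = (if i \<in> T then - y i else if i \<in> D' then y i else 1)" if i: "i \<in> E" "i \<noteq> m" for i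
    proof (cases "i \<in> T")
      case True
      then show ?thesis using A_T[OF True] by (simp add: B_def left_sum_def)
    next
      case False
      then show ?thesis using A_1[OF i False] y1[OF i] i by (auto simp: B_def left_sum_def D'_def)
    qed
    have Bm: "B m = max (A m) (y m)" using A_m ym by (auto simp: B_def left_sum_def)
    show ?thesis
    proof (cases "k = 1")
      case True
      then have "B m = max 1 (y m)" using Bm A_m s(3) by (simp add: y_def)
      then show ?thesis using BS B by blast
    next
      case False
      then obtain n where n: "n \<in> D" "k = U n n / - s n" using kK by (auto simp: K_def)
      have nE: "n \<in> E" "n \<noteq> m" and "s n < - 1" using n(1) by (auto simp: D_def)
      then have yn: "y n = - U n n" using n(2) by (simp add: y_def)
      \<comment> \<open>For \<open>k < 1\<close> the minimum is attained at some \<open>n\<close>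
        with \<open>U n n = - y n\<close>. Adding \<open>U n\<close> on the right only raises the
        entry at \<open>m\<close> to at least 1.\<close>
      define C where "C = left_sum B (U n)"
      have "C \<in> S" unfolding C_def using left_cone_left_sum[OF cone BS U(1)[OF nE(1)]] .
      moreover have "C m = max 1 (y m)"
        using Bm A_m ym U(2)[OF nE(1) m] nE by (auto simp: C_def left_sum_def)
      moreover have "C i = B i" if i: "i \<in> E" "i \<noteq> m" for i
      proof (cases "i = n")
        case True
        then show ?thesis using B[OF i] yn Un[OF nE] i by (auto simp: C_def left_sum_def D'_def)
      next
        case False
        then have "\<bar>U n i\<bar> \<le> \<bar>B i\<bar>" using B[OF i] U(2)[OF nE(1) i(1)] T by (auto simp: D'_def)
        then show ?thesis by (simp add: C_def left_sum_def)
      qed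
      ultimately show ?thesis using B by (intro bexI[of _ C]) auto
    qed
  qed
  have fill: "\<exists>u\<in>S. u m = max 1 (y m) \<and> (\<forall>i\<in>E - {m}.
      u i = (if i \<in> F then 1 else if i \<in> T then - y i else if i \<in> D' then y i else 1))"
    if "F \<subseteq> D'" "T \<subseteq> D'" for F T
  proof -
    have "finite F" using that(1) fD' finite_subset by blast
    then show ?thesis using that
    \<comment> \<open>The step joins two corners, with \<open>n\<close> in \<open>T\<close> and not
      in \<open>T\<close>, by a segment along \<open>n\<close> that passes through 1.\<close>
    proof (induction F arbitrary: T)
      case empty
      then show ?case using corner by simp
    next
      case (insert n F)
      have n: "n \<in> D'" "n \<in> E" "n \<noteq> m" using insert.prems by (auto simp: D'_def)
      obtain u where u: "u \<in> S" "u m = max 1 (y m)"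
        "\<forall>i\<in>E - {m}. u i = (if i \<in> F then 1 else if i \<in> insert n T then - y i else if i \<in> D' then y i else 1)"
        using insert.IH[of "insert n T"] insert.prems by auto
      obtain v where v: "v \<in> S" "v m = max 1 (y m)"
        "\<forall>i\<in>E - {m}. v i = (if i \<in> F then 1 else if i \<in> T - {n} then - y i else if i \<in> D' then y i else 1)"
        using insert.IH[of "T - {n}"] insert.prems by auto
      have "u j = v j" if "j \<in> E" "j \<noteq> n" for j
        using u(2,3) v(2,3) that by (cases "j = m") auto
      moreover have "u n = - y n" "v n = y n" using u(3) v(3) n insert.hyps by auto
      moreover have "y n < - 1" using n by (simp add: D'_def)
      ultimately obtain x where x: "x \<in> S" "\<And>j. j \<in> E \<Longrightarrow> j \<noteq> n \<Longrightarrow> x j = u j" "x n = 1"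
        using tc_cone_segment[OF S u(1) v(1) n(2), of 1] by force
      show ?case
      proof (intro bexI[OF _ x(1)] conjI ballI)
        show "x m = max 1 (y m)" using x(2)[OF m] n u(2) by simp
        show "x i = (if i \<in> insert n F then 1 else if i \<in> T then - y i else if i \<in> D' then y i else 1)"
          if "i \<in> E - {m}" for i
          using x(2)[of i] x(3) u(3) that by (cases "i = n") auto
      qed
    qed
  qed
  obtain u where u: "u \<in> S" "u m = max 1 (y m)" "\<forall>i\<in>E - {m}. u i = 1"
    using fill[of D' "{}"] by auto
  have "U m j = u j" if "j \<in> E" "j \<noteq> m" for j using U(2)[OF m that] u(3) that by simp
  then obtain x where x: "x \<in> S" "\<And>j. j \<in> E \<Longrightarrow> j \<noteq> m \<Longrightarrow> x j = U m j" "x m = 1"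
    using tc_cone_segment[OF S U(1)[OF m] u(1) m, of 1] Um u(2) by auto
  have "x i = 1" if "i \<in> E" for i using x(2,3) U(2)[OF m that] that by (cases "i = m") auto
  then show ?thesis using x(1) by blast
qed

text \<open>\<open>U n\<close> equals 1 on \<open>E\<close> except possibly at \<open>n\<close>. Two
  diagonal entries below 1 are cured by a left sum; if all exceed 1, each \<open>U n\<close> is
  rescaled to 1 at \<open>n\<close>. A single one below 1, at \<open>m\<close>, needs the
  certificate with only the sign at \<open>m\<close> flipped.\<close>

lemma orthants_merge_ones:
  fixes S :: "('i \<Rightarrow> real) set"
  assumes E: "finite E" and S: "tc_cone E S"
    and cert: "\<And>\<sigma>. (\<And>i. \<sigma> i \<in> {- 1, 1 :: real}) \<Longrightarrow> \<exists>s\<in>S. \<forall>i\<in>E. \<sigma> i * s i \<le> \<sigma> i"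
    and drop: "\<And>n. n \<in> E \<Longrightarrow> \<exists>u\<in>S. 0 \<le> u n \<and> (\<forall>i\<in>E - {n}. u i = 1)"
  shows "\<exists>u\<in>S. \<forall>i\<in>E. u i = 1"
proof -
  note cone = tc_cone_left_cone[OF S]
  have "\<forall>n\<in>E. \<exists>u. u \<in> S \<and> 0 \<le> u n \<and> (\<forall>i\<in>E - {n}. u i = 1)" using drop by blast
  from bchoice[OF this] obtain U where U: "\<And>n. n \<in> E \<Longrightarrow> U n \<in> S" "\<And>n. n \<in> E \<Longrightarrow> 0 \<le> U n n"
    "\<And>n i. n \<in> E \<Longrightarrow> i \<in> E \<Longrightarrow> i \<noteq> n \<Longrightarrow> U n i = 1" by auto
  consider n where "n \<in> E" "U n n = 1"
    | n m where "n \<in> E" "m \<in> E" "n \<noteq> m" "U n n < 1" "U m m < 1"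
    | "\<forall>n\<in>E. 1 < U n n"
    | m where "m \<in> E" "U m m < 1" "\<forall>n\<in>E. n \<noteq> m \<longrightarrow> 1 < U n n"
    by (metis linorder_neqE_linordered_idom)
  then show ?thesis
  proof cases
    case 1
    then have "\<forall>i\<in>E. U n i = 1" using U(3)[OF 1(1)] by metis
    then show ?thesis using U(1) 1(1) by blast
  next
    case 2
    have "left_sum (U n) (U m) i = 1" if i: "i \<in> E" for i
      using U(3)[OF 2(1) i] U(3)[OF 2(2) i] U(2)[OF 2(1)] U(2)[OF 2(2)] 2
      by (cases "i = n"; cases "i = m") (auto simp: left_sum_def)
    then show ?thesis using left_cone_left_sum[OF cone U(1)[OF 2(1)] U(1)[OF 2(2)]] by blast
  next
    case 3
    define g where "g n = (\<lambda>i. (1 / U n n) * U n i)" for n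
    have gS: "\<And>n. n \<in> E \<Longrightarrow> g n \<in> S"
      unfolding g_def using 3 U(1) by (intro left_cone_scale[OF cone]) (auto intro: order.strict_trans[OF zero_less_one])
    obtain u where u: "u \<in> S" "\<And>i n. n \<in> E \<Longrightarrow> \<bar>g n i\<bar> \<le> \<bar>u i\<bar>"
      "\<And>i. u i = 0 \<or> (\<exists>n\<in>E. u i = g n i)"
      using left_cone_family[of S E g, OF cone E gS] by blast
    have "u i = 1" if i: "i \<in> E" for i
    proof -
      have gi: "g i i = 1" using 3 i by (force simp: g_def)
      then have big: "1 \<le> \<bar>u i\<bar>" using u(2)[OF i, of i] by simp
      then obtain n where n: "n \<in> E" "u i = g n i" using u(3)[of i] by auto
      have "n = i"
      proof (rule ccontr)
        assume "n \<noteq> i"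
        then have "g n i = 1 / U n n" using U(3)[OF n(1) i] by (simp add: g_def)
        moreover have "1 < U n n" using 3 n(1) by blast
        ultimately show False using big n(2) by (simp add: abs_if split: if_splits)
      qed
      then show ?thesis using gi n by simp
    qed
    then show ?thesis using u(1) by blast
  next
    case 4
    define \<sigma> :: "'i \<Rightarrow> real" where "\<sigma> i = (if i = m then - 1 else 1)" for i
    have "\<exists>s\<in>S. \<forall>i\<in>E. \<sigma> i * s i \<le> \<sigma> i" by (rule cert) (simp add: \<sigma>_def)
    then obtain s where s: "s \<in> S" "\<And>i. i \<in> E \<Longrightarrow> \<sigma> i * s i \<le> \<sigma> i" by blast
    have "s i \<le> 1" if "i \<in> E" "i \<noteq> m" for i using s(2)[OF that(1)] that(2) by (simp add: \<sigma>_def)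
    moreover have "1 \<le> s m" using s(2)[OF 4(1)] by (simp add: \<sigma>_def)
    ultimately show ?thesis
      by (intro orthants_merge_corners[OF E S 4(1), of U s]) (use U 4 s(1) in auto)
  qed
qed

text \<open>Forgetting \<open>n\<close> in a half-cone gives vectors correct away from
  \<open>n\<close>. If \<open>z n = 0\<close>, both half-cones are available and a segment through 0
  finishes; if no entry vanishes, dividing by \<open>z\<close> reduces to ones.\<close>

lemma orthants_merge:
  fixes S :: "('i \<Rightarrow> real) set"
  assumes E: "finite E" and S: "tc_cone E S"
    and cert: "\<And>\<sigma>. (\<And>i. \<sigma> i \<in> {- 1, 1 :: real}) \<Longrightarrow> \<exists>s\<in>S. \<forall>i\<in>E. \<sigma> i * s i \<le> \<sigma> i * z i"
  shows "\<exists>u\<in>S. \<forall>i\<in>E. u i = z i"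
  using E S cert
proof (induction E arbitrary: S rule: finite_psubset_induct)
  case (psubset E)
  have drop: "\<exists>u\<in>S. 0 \<le> \<tau> * u n \<and> (\<forall>i\<in>E - {n}. u i = z i)"
    if n: "n \<in> E" and \<tau>: "\<tau> \<noteq> 0" "0 \<le> \<tau> * z n" for n \<tau>
  proof -
    have sub: "E - {n} \<subset> E" using n by auto
    have "\<exists>u\<in>{s \<in> S. 0 \<le> \<tau> * s n}. \<forall>i\<in>E - {n}. u i = z i"
    proof (rule psubset.IH[OF sub tc_cone_drop[OF psubset.prems(1) n \<tau>(1)]])
      fix \<sigma> :: "'i \<Rightarrow> real" assume \<sigma>: "\<And>i. \<sigma> i \<in> {- 1, 1}"
      \<comment> \<open>With sign \<open>- sgn \<tau>\<close> at \<open>n\<close>, the certificate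
        lies at or beyond \<open>z n\<close> in the direction of \<open>\<tau>\<close>, hence in the
        half-cone.\<close>
      have "(\<sigma>(n := - sgn \<tau>)) i \<in> {- 1, 1}" for i using \<sigma>[of i] \<tau>(1) by (auto simp: sgn_if)
      from psubset.prems(2)[of "\<sigma>(n := - sgn \<tau>)", OF this] obtain s where s: "s \<in> S"
        "\<And>i. i \<in> E \<Longrightarrow> (\<sigma>(n := - sgn \<tau>)) i * s i \<le> (\<sigma>(n := - sgn \<tau>)) i * z i" by blast
      have "0 \<le> \<tau> * s n"
        using s(2)[OF n] \<tau> by (cases "\<tau> > 0") (auto simp: zero_le_mult_iff sgn_if)
      moreover have "\<sigma> i * s i \<le> \<sigma> i * z i" if "i \<in> E - {n}" for i using s(2)[of i] that by simp
      ultimately show "\<exists>s\<in>{s \<in> S. 0 \<le> \<tau> * s n}. \<forall>i\<in>E - {n}. \<sigma> i * s i \<le> \<sigma> i * z i"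
        using s(1) by blast
    qed
    then show ?thesis by blast
  qed
  show ?case
  proof (cases "\<exists>n\<in>E. z n = 0")
    case True
    then obtain n where n: "n \<in> E" "z n = 0" by blast
    obtain u where u: "u \<in> S" "0 \<le> 1 * u n" "\<forall>i\<in>E - {n}. u i = z i" using drop[OF n(1), of 1] n(2) by auto
    obtain v where v: "v \<in> S" "0 \<le> - 1 * v n" "\<forall>i\<in>E - {n}. v i = z i" using drop[OF n(1), of "- 1"] n(2) by auto
    have eq: "\<And>j. j \<in> E \<Longrightarrow> j \<noteq> n \<Longrightarrow> u j = v j" using u(3) v(3) by auto
    have "u n \<le> z n \<and> z n \<le> v n \<or> v n \<le> z n \<and> z n \<le> u n" using u(2) v(2) n(2) by auto
    then obtain x where "x \<in> S" "\<And>j. j \<in> E \<Longrightarrow> j \<noteq> n \<Longrightarrow> x j = u j" "x n = z n"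
      using tc_cone_segment[OF psubset.prems(1) u(1) v(1) n(1) eq] by blast
    then show ?thesis using u(3) by (metis Diff_iff singletonD)
  next
    case False
    define d where "d i = (if i \<in> E then 1 / z i else 1)" for i
    have d: "d i \<noteq> 0" "i \<in> E \<Longrightarrow> d i * z i = 1" for i using False by (auto simp: d_def)
    let ?S = "(\<lambda>s i. d i * s i) ` S"
    have "\<exists>u\<in>?S. \<forall>i\<in>E. u i = 1"
    proof (rule orthants_merge_ones[OF psubset.hyps tc_cone_diag[OF psubset.prems(1) d(1)]])
      fix \<sigma> :: "'i \<Rightarrow> real" assume \<sigma>: "\<And>i. \<sigma> i \<in> {- 1, 1}"
      define \<sigma>' where "\<sigma>' i = (if d i < 0 then - \<sigma> i else \<sigma> i)" for i
      have "\<sigma>' i \<in> {- 1, 1}" for i using \<sigma>[of i] by (auto simp: \<sigma>'_def)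
      then obtain s where s: "s \<in> S" "\<And>i. i \<in> E \<Longrightarrow> \<sigma>' i * s i \<le> \<sigma>' i * z i"
        using psubset.prems(2) by blast
      have "\<sigma> i * (d i * s i) \<le> \<sigma> i" if i: "i \<in> E" for i
      proof -
        have "\<bar>d i\<bar> * (\<sigma>' i * s i) \<le> \<bar>d i\<bar> * (\<sigma>' i * z i)" using s(2)[OF i] by (rule mult_left_mono) simp
        moreover have "\<bar>d i\<bar> * (\<sigma>' i * t) = \<sigma> i * (d i * t)" for t by (simp add: \<sigma>'_def)
        ultimately show ?thesis using d(2)[OF i] by simp
      qed
      then show "\<exists>s\<in>?S. \<forall>i\<in>E. \<sigma> i * s i \<le> \<sigma> i"
        by (intro bexI[OF _ imageI[OF s(1)]] ballI)
    next
      fix n assume n: "n \<in> E"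
      have zn: "z n \<noteq> 0" using False n by blast
      then obtain u where u: "u \<in> S" "0 \<le> z n * u n" "\<forall>i\<in>E - {n}. u i = z i"
        using drop[OF n, of "z n"] by auto
      have "0 \<le> d n * u n" using u(2) n zn by (auto simp: d_def zero_le_mult_iff zero_le_divide_iff)
      moreover have "\<forall>i\<in>E - {n}. d i * u i = 1" using u(3) d(2) by simp
      ultimately show "\<exists>u\<in>?S. 0 \<le> u n \<and> (\<forall>i\<in>E - {n}. u i = 1)"
        using u(1) by (intro bexI[OF _ imageI[OF u(1)]]) auto
    qed
    then obtain u where u: "u \<in> S" "\<forall>i\<in>E. d i * u i = 1" by auto
    have "u i = z i" if "i \<in> E" for i
    proof -
      have "d i * u i = d i * z i" using u(2) d(2) that by simp
      then show ?thesis using d(1)[of i] by simp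
    qed
    then show ?thesis using u(1) by blast
  qed
qed

text \<open>Reflection by \<open>\<sigma>\<close> makes normal vectors of that sign pattern
  nonnegative, so \<open>orthant_alternative\<close> supplies the certificates to be merged.\<close>

theorem tc_cone_separation:
  fixes S :: "('i \<Rightarrow> real) set"
  assumes E: "finite E" and S: "tc_cone E S" and X: "finite X" "X \<subseteq> S"
    and sep: "\<And>a. (\<And>x. x \<in> X \<Longrightarrow> weakly_nonneg E a x) \<Longrightarrow> weakly_nonneg E a z"
  shows "\<exists>u\<in>S. \<forall>i\<in>E. u i = z i"
proof (rule orthants_merge[OF E S])
  fix \<sigma> :: "'i \<Rightarrow> real" assume \<sigma>: "\<And>i. \<sigma> i \<in> {- 1, 1}"
  have \<sigma>0: "\<sigma> i \<noteq> 0" for i using \<sigma>[of i] by auto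
  have "\<exists>s\<in>(\<lambda>s i. \<sigma> i * s i) ` S. \<forall>i\<in>E. s i \<le> \<sigma> i * z i"
  proof (rule orthant_alternative[OF E left_cone_diag[OF tc_cone_left_cone[OF S] \<sigma>0]])
    show "finite ((\<lambda>s i. \<sigma> i * s i) ` X)" "(\<lambda>s i. \<sigma> i * s i) ` X \<subseteq> (\<lambda>s i. \<sigma> i * s i) ` S"
      using X by auto
    fix a assume "\<And>x. x \<in> (\<lambda>s i. \<sigma> i * s i) ` X \<Longrightarrow> weakly_nonneg E a x"
    then show "weakly_nonneg E a (\<lambda>i. \<sigma> i * z i)"
      using sep[of "\<lambda>i. \<sigma> i * a i"] by (force simp: weakly_nonneg_diag)
  qed
  then show "\<exists>s\<in>S. \<forall>i\<in>E. \<sigma> i * s i \<le> \<sigma> i * z i" by auto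
qed

section \<open>Signed tropical numbers as real numbers\<close>

text \<open>Balanced numbers have no real counterpart; their value \<open>0\<close> is a dummy.\<close>

fun val :: "symtrop \<Rightarrow> real" where
  "val TZero = 0"
| "val (TNum TPlus r) = exp r"
| "val (TNum TMinus r) = - exp r"
| "val (TNum TBal r) = 0"

text \<open>The element of the symmetrized semiring whose largest positive term has absolute value \<open>p\<close> and
  whose largest negative term has absolute value \<open>n\<close>; addition becomes a pair of maxima.\<close>

definition of_pair :: "real \<Rightarrow> real \<Rightarrow> symtrop" where
  "of_pair p n = (if n < p then TNum TPlus (ln p) else if p < n then TNum TMinus (ln n)
     else if p = 0 then TZero else TNum TBal (ln p))"

lemma of_pair_add:
  assumes "0 \<le> p" "0 \<le> n" "0 \<le> p'" "0 \<le> n'"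
  shows "of_pair p n + of_pair p' n' = of_pair (max p p') (max n n')"
  using assms unfolding of_pair_def plus_symtrop_def by auto

definition of_val :: "real \<Rightarrow> symtrop" where
  "of_val v = of_pair (max v 0) (max (- v) 0)"

lemma of_val_simps:
  "v > 0 \<Longrightarrow> of_val v = TNum TPlus (ln v)" "v < 0 \<Longrightarrow> of_val v = TNum TMinus (ln (- v))" "of_val 0 = TZero"
  by (simp_all add: of_val_def of_pair_def max_def)

lemma of_val_signed: "of_val v \<in> T_signed"
  by (cases v "0 :: real" rule: linorder_cases)
    (simp_all add: of_val_simps T_signed_def T_pos_def T_neg_def zero_symtrop_def)

lemma val_of_val [simp]: "val (of_val v) = v"
  by (cases v "0 :: real" rule: linorder_cases) (simp_all add: of_val_simps)

lemma T_signed_cases: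
  assumes "x \<in> T_signed"
  obtains "x = TZero" | r where "x = TNum TPlus r" | r where "x = TNum TMinus r"
  using assms by (auto simp: T_signed_def T_pos_def T_neg_def zero_symtrop_def)

lemma of_val_val: "x \<in> T_signed \<Longrightarrow> of_val (val x) = x"
  by (erule T_signed_cases) (simp_all add: of_val_simps)

lemma T_signed_mult:
  "x \<in> T_signed \<Longrightarrow> y \<in> T_signed \<Longrightarrow> x * y \<in> T_signed \<and> val (x * y) = val x * val y"
  by (elim T_signed_cases) (auto simp: times_symtrop_def T_signed_def T_pos_def T_neg_def zero_symtrop_def exp_add)

lemma of_pair_nonneg_iff: "0 \<le> p \<Longrightarrow> 0 \<le> n \<Longrightarrow> of_pair p n \<in> T_pos \<union> T_bal \<longleftrightarrow> n \<le> p"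
  by (auto simp: of_pair_def T_pos_def T_bal_def zero_symtrop_def)

text \<open>Addition of pairs takes maxima; 0 is the default when there is no positive, or no
  negative, term.\<close>

lemma sum_signed:
  assumes "finite I" "\<And>i. i \<in> I \<Longrightarrow> f i \<in> T_signed"
  shows "\<exists>p n. sum f I = of_pair p n \<and> 0 \<le> p \<and> 0 \<le> n \<and> (\<forall>i\<in>I. val (f i) \<le> p \<and> - val (f i) \<le> n) \<and>
    (p = 0 \<or> (\<exists>i\<in>I. val (f i) = p)) \<and> (n = 0 \<or> (\<exists>i\<in>I. - val (f i) = n))"
  using assms
proof (induction I)
  case empty
  show ?case by (intro exI[of _ 0]) (auto simp: of_pair_def zero_symtrop_def)
next
  case (insert j I)
  then obtain p n where pn: "sum f I = of_pair p n" "0 \<le> p" "0 \<le> n"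
    "\<forall>i\<in>I. val (f i) \<le> p \<and> - val (f i) \<le> n"
    "p = 0 \<or> (\<exists>i\<in>I. val (f i) = p)" "n = 0 \<or> (\<exists>i\<in>I. - val (f i) = n)" by auto
  define v where "v = val (f j)"
  have "f j = of_pair (max v 0) (max (- v) 0)"
    using of_val_val[of "f j"] insert.prems by (simp add: of_val_def v_def)
  then have "sum f (insert j I) = of_pair (max (max v 0) p) (max (max (- v) 0) n)"
    using insert.hyps pn(1-3) of_pair_add by simp
  moreover have "\<forall>i\<in>insert j I. val (f i) \<le> max (max v 0) p \<and> - val (f i) \<le> max (max (- v) 0) n"
    using pn(4) by (auto simp: v_def)
  moreover have "max (max v 0) p = 0 \<or> (\<exists>i\<in>insert j I. val (f i) = max (max v 0) p)"
    using pn(2,5) by (auto simp: v_def max_def)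
  moreover have "max (max (- v) 0) n = 0 \<or> (\<exists>i\<in>insert j I. - val (f i) = max (max (- v) 0) n)"
    using pn(3,6) by (auto simp: v_def max_def)
  moreover have "0 \<le> max (max v 0) p" "0 \<le> max (max (- v) 0) n" by auto
  ultimately show ?case by blast
qed

lemma sum_signed_iff:
  assumes "finite I" "\<And>i. i \<in> I \<Longrightarrow> f i \<in> T_signed"
  shows "sum f I \<in> T_pos \<union> T_bal \<longleftrightarrow> (\<forall>i\<in>I. val (f i) < 0 \<longrightarrow> (\<exists>j\<in>I. - val (f i) \<le> val (f j)))"
proof -
  from sum_signed[of I f, OF assms] obtain p n where pn: "sum f I = of_pair p n" "0 \<le> p" "0 \<le> n"
    "\<forall>i\<in>I. val (f i) \<le> p \<and> - val (f i) \<le> n"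
    "p = 0 \<or> (\<exists>i\<in>I. val (f i) = p)" "n = 0 \<or> (\<exists>i\<in>I. - val (f i) = n)" by blast
  have "n \<le> p \<longleftrightarrow> (\<forall>i\<in>I. val (f i) < 0 \<longrightarrow> (\<exists>j\<in>I. - val (f i) \<le> val (f j)))"
  proof
    assume "n \<le> p"
    show "\<forall>i\<in>I. val (f i) < 0 \<longrightarrow> (\<exists>j\<in>I. - val (f i) \<le> val (f j))"
    proof (intro ballI impI)
      fix i assume i: "i \<in> I" "val (f i) < 0"
      then have "- val (f i) \<le> p" "p \<noteq> 0" using pn(4) \<open>n \<le> p\<close> by force+
      then show "\<exists>j\<in>I. - val (f i) \<le> val (f j)" using pn(5) by auto
    qed
  next
    assume r: "\<forall>i\<in>I. val (f i) < 0 \<longrightarrow> (\<exists>j\<in>I. - val (f i) \<le> val (f j))"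
    show "n \<le> p"
    proof (cases "n = 0")
      case False
      then obtain i where i: "i \<in> I" "- val (f i) = n" using pn(6) by blast
      then obtain j where "j \<in> I" "n \<le> val (f j)" using r pn(3) False by force
      then show ?thesis using pn(4) by force
    qed (use pn(2) in simp)
  qed
  then show ?thesis using of_pair_nonneg_iff[OF pn(2,3)] pn(1) by simp
qed

section \<open>Homogenisation of points and halfspaces\<close>

definition homog :: "symtrop \<Rightarrow> symtrop ^ 'd \<Rightarrow> 'd option \<Rightarrow> real" where
  "homog c x = (\<lambda>i. case i of None \<Rightarrow> val c | Some j \<Rightarrow> val (x $ j))"

lemma homog_simps [simp]: "homog c x None = val c" "homog c x (Some j) = val (x $ j)"
  by (simp_all add: homog_def)

lemma val_one [simp]: "val 1 = 1"
  by (simp add: one_symtrop_def)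

lemma mem_closed_halfspace:
  fixes x :: "symtrop ^ 'd"
  assumes "c \<in> T_signed" "a \<in> T_signed_vec" "x \<in> T_signed_vec"
  shows "x \<in> closed_halfspace c a \<longleftrightarrow> weakly_nonneg UNIV (homog c a) (homog 1 x)"
proof -
  define f where "f i = (case i of None \<Rightarrow> c | Some j \<Rightarrow> a $ j * x $ j)" for i
  have ax: "a $ j * x $ j \<in> T_signed \<and> val (a $ j * x $ j) = val (a $ j) * val (x $ j)" for j
    using assms T_signed_mult by (simp add: T_signed_vec_def)
  have f: "f i \<in> T_signed" for i using ax assms(1) by (simp add: f_def split: option.split)
  have vf: "val (f i) = homog c a i * homog 1 x i" for i
    using ax by (simp add: f_def homog_def split: option.split)
  have "sum f UNIV = c + (\<Sum>j\<in>UNIV. a $ j * x $ j)"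
    by (simp add: UNIV_option_conv sum.reindex f_def)
  then show ?thesis
    using sum_signed_iff[of UNIV f] f assms(3) by (simp add: closed_halfspace_def weakly_nonneg_def vf)
qed

section \<open>Separation from TC hulls\<close>

definition cone_over :: "(symtrop ^ 'd) set \<Rightarrow> ('d option \<Rightarrow> real) set" where
  "cone_over M = {v. v = (\<lambda>_. 0) \<or> (\<exists>c>0. \<exists>x\<in>M. v = (\<lambda>i. c * homog 1 x i))}"

lemma cone_over_None:
  "s \<in> cone_over M \<Longrightarrow> 0 \<le> s None"
  "s \<in> cone_over M \<Longrightarrow> s None = 0 \<Longrightarrow> s = (\<lambda>_. 0)"
  by (auto simp: cone_over_def)

text \<open>Reduces closure of the cone to closure of halfspaces: a nonzero \<open>u\<close>
  dehomogenises to a point of \<open>conv_TC2 x y\<close>, where \<open>x\<close> and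
  \<open>y\<close> span the rays of \<open>s\<close> and \<open>t\<close>.\<close>

lemma cone_over_closed:
  fixes M :: "(symtrop ^ 'd) set"
  assumes M: "TC_convex M" and s: "s \<in> cone_over M" and t: "t \<in> cone_over M"
    and u: "0 \<le> u None" "u None = 0 \<Longrightarrow> u = (\<lambda>_. 0)"
    and weakly_nonneg: "\<And>a. weakly_nonneg UNIV a s \<Longrightarrow> weakly_nonneg UNIV a t \<Longrightarrow> weakly_nonneg UNIV a u"
  shows "u \<in> cone_over M"
proof (cases "u None = 0")
  case True
  then show ?thesis using u(2) by (simp add: cone_over_def)
next
  case False
  define c where "c = u None"
  have c: "c > 0" using u(1) False by (simp add: c_def)
  have zero: "weakly_nonneg UNIV a (\<lambda>_. 0)" for a :: "'d option \<Rightarrow> real" by (simp add: weakly_nonneg_def)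
  have nz: "s \<noteq> (\<lambda>_. 0) \<or> t \<noteq> (\<lambda>_. 0)"
  proof (rule ccontr)
    assume "\<not> ?thesis"
    then have "weakly_nonneg UNIV (\<lambda>i. if i = None then - 1 else 0) u" by (intro weakly_nonneg) (auto simp: zero)
    then show False using c unfolding weakly_nonneg_def c_def by (auto split: if_splits dest!: bspec[of _ _ None])
  qed
  have ray: "v = (\<lambda>_. 0) \<or> (\<exists>x\<in>M. \<forall>a. weakly_nonneg UNIV a (homog 1 x) \<longrightarrow> weakly_nonneg UNIV a v)" if v: "v \<in> cone_over M" for v
  proof (cases "v = (\<lambda>_. 0)")
    case False
    then obtain k x where "k > 0" "x \<in> M" "v = (\<lambda>i. k * homog 1 x i)"
      using v unfolding cone_over_def by blast
    then show ?thesis using weakly_nonneg_scale[of k UNIV _ "homog 1 x"] by blast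
  qed simp
  \<comment> \<open>The zero vector satisfies every halfspace, so if \<open>s\<close> or
    \<open>t\<close> is zero, the point of the other serves twice.\<close>
  obtain x y where xy: "x \<in> M" "y \<in> M"
    "\<And>a. weakly_nonneg UNIV a (homog 1 x) \<Longrightarrow> weakly_nonneg UNIV a (homog 1 y) \<Longrightarrow> weakly_nonneg UNIV a u"
  proof (cases "s = (\<lambda>_. 0)")
    case True
    then obtain y where "y \<in> M" "\<forall>a. weakly_nonneg UNIV a (homog 1 y) \<longrightarrow> weakly_nonneg UNIV a t" using ray[OF t] nz by blast
    then show ?thesis using that[of y y] weakly_nonneg True zero by blast
  next
    case s0: False
    then obtain x where x: "x \<in> M" "\<forall>a. weakly_nonneg UNIV a (homog 1 x) \<longrightarrow> weakly_nonneg UNIV a s" using ray[OF s] by blast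
    show ?thesis
    proof (cases "t = (\<lambda>_. 0)")
      case True
      then show ?thesis using that[of x x] x weakly_nonneg zero by blast
    next
      case False
      then obtain y where "y \<in> M" "\<forall>a. weakly_nonneg UNIV a (homog 1 y) \<longrightarrow> weakly_nonneg UNIV a t" using ray[OF t] by blast
      then show ?thesis using that[of x y] x weakly_nonneg by blast
    qed
  qed
  define p :: "symtrop ^ 'd" where "p = (\<chi> j. of_val (u (Some j) / c))"
  have p: "p \<in> T_signed_vec" by (simp add: p_def T_signed_vec_def of_val_signed)
  have up: "u = (\<lambda>i. c * homog 1 p i)"
  proof
    show "u i = c * homog 1 p i" for i using c by (cases i) (simp_all add: p_def c_def)
  qed
  have xyT: "x \<in> T_signed_vec" "y \<in> T_signed_vec" using M xy(1,2) by (auto simp: TC_convex_def)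
  have "p \<in> H" if H: "H \<in> closed_halfspaces" "x \<in> H" "y \<in> H" for H
  proof -
    obtain a0 a where a: "H = closed_halfspace a0 a" "a0 \<in> T_signed" "a \<in> T_signed_vec"
      using H(1) unfolding closed_halfspaces_def by blast
    have "weakly_nonneg UNIV (homog a0 a) u"
      using H(2,3) mem_closed_halfspace[OF a(2,3)] xyT xy(3) unfolding a(1) by blast
    then show ?thesis using mem_closed_halfspace[OF a(2,3) p] weakly_nonneg_scale[OF c] unfolding a(1) up by blast
  qed
  then have "p \<in> conv_TC2 x y" using p by (simp add: conv_TC2_def)
  then have "p \<in> M" using M xy(1,2) unfolding TC_convex_def by blast
  then show ?thesis using c up unfolding cone_over_def by blast
qed

lemma tc_cone_cone_over:
  fixes M :: "(symtrop ^ 'd) set"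
  assumes M: "TC_convex M"
  shows "tc_cone UNIV (cone_over M)"
  unfolding tc_cone_def left_cone_def
proof (intro conjI ballI allI impI)
  show "(\<lambda>_. 0) \<in> cone_over M" by (simp add: cone_over_def)
next
  fix c :: real and s assume c: "0 < c" and s: "s \<in> cone_over M"
  show "(\<lambda>i. c * s i) \<in> cone_over M"
    by (rule cone_over_closed[OF M s s]) (use c cone_over_None(1)[OF s] cone_over_None(2)[OF s] in \<open>auto simp: weakly_nonneg_scale\<close>)
next
  fix s t assume st: "s \<in> cone_over M" "t \<in> cone_over M"
  show "left_sum s t \<in> cone_over M"
  proof (rule cone_over_closed[OF M st])
    show "0 \<le> left_sum s t None" using st cone_over_None(1) by (auto simp: left_sum_def)
    show "left_sum s t = (\<lambda>_. 0)" if "left_sum s t None = 0"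
    proof -
      have "s None = 0" "t None = 0" using that by (auto simp: left_sum_def split: if_splits)
      then show ?thesis using cone_over_None(2)[OF st(1)] cone_over_None(2)[OF st(2)] by (simp add: left_sum_def)
    qed
  qed (rule weakly_nonneg_left_sum; simp)
next
  fix s t i v
  assume st: "s \<in> cone_over M" "t \<in> cone_over M" and eq: "\<forall>j\<in>UNIV - {i}. s j = t j"
    and v: "s i \<le> v" "v \<le> t i"
  have "s(i := v) \<in> cone_over M"
  proof (rule cone_over_closed[OF M st])
    show "0 \<le> (s(i := v)) None" using cone_over_None(1)[OF st(1)] v by auto
    show "s(i := v) = (\<lambda>_. 0)" if 0: "(s(i := v)) None = 0"
    proof -
      have sN: "s None = 0" using 0 v cone_over_None(1)[OF st(1)] by (cases "i = None") auto
      have s0: "s = (\<lambda>_. 0)" using cone_over_None(2)[OF st(1) sN] .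
      show ?thesis
      proof (cases "i = None")
        case True
        then show ?thesis using 0 s0 by auto
      next
        case False
        then have "t None = 0" using eq sN by auto
        then have "t i = 0" using cone_over_None(2)[OF st(2)] by simp
        then show ?thesis using v s0 by auto
      qed
    qed
    show "weakly_nonneg UNIV a (s(i := v))" if "weakly_nonneg UNIV a s" "weakly_nonneg UNIV a t" for a
      by (rule weakly_nonneg_segment[OF _ _ that]) (use eq v in auto)
  qed
  then show "\<exists>u\<in>cone_over M. (\<forall>j\<in>UNIV - {i}. u j = s j) \<and> u i = v"
    by (intro bexI[of _ "s(i := v)"]) auto
qed

lemma TC_convex_conv_TC:
  fixes X :: "(symtrop ^ 'd) set"
  assumes "X \<subseteq> T_signed_vec"
  shows "TC_convex (conv_TC X)"
proof -
  have "TC_convex (T_signed_vec :: (symtrop ^ 'd) set)"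
    by (auto simp: TC_convex_def conv_TC2_def)
  then have "conv_TC X \<subseteq> T_signed_vec"
    unfolding conv_TC_def using assms by (rule hull_minimal[rotated])
  moreover have "conv_TC2 x y \<subseteq> conv_TC X" if "x \<in> conv_TC X" "y \<in> conv_TC X" for x y
    using that unfolding conv_TC_def hull_def TC_convex_def by blast
  ultimately show ?thesis by (simp add: TC_convex_def)
qed

text \<open>A ray of the cone has only one point with entry 1 at \<open>None\<close>, so
  \<open>z\<close> outside the hull is outside the cone over it. The vector \<open>a\<close> may
  still vanish here.\<close>

lemma TC_separation:
  fixes X :: "(symtrop ^ 'd) set"
  assumes X: "finite X" "X \<subseteq> T_signed_vec" and z: "z \<in> T_signed_vec" "z \<notin> conv_TC X"
  obtains c a where "c \<in> T_signed" "a \<in> T_signed_vec" "X \<subseteq> closed_halfspace c a" "z \<notin> closed_halfspace c a"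
proof -
  let ?S = "cone_over (conv_TC X)"
  have "homog 1 z \<notin> ?S"
  proof
    assume "homog 1 z \<in> ?S"
    then obtain k x where k: "x \<in> conv_TC X" "homog 1 z = (\<lambda>i. k * homog 1 x i)"
      unfolding cone_over_def by (auto dest: fun_cong[of _ _ None])
    have "k = 1" using fun_cong[OF k(2), of None] by simp
    have "x \<in> T_signed_vec" using TC_convex_conv_TC[OF X(2)] k(1) by (auto simp: TC_convex_def)
    then have "z $ j = x $ j" for j
      using fun_cong[OF k(2), of "Some j"] \<open>k = 1\<close> z(1) of_val_val by (metis T_signed_vec_def homog_simps(2) mem_Collect_eq mult_1)
    then have "z = x" by (simp add: vec_eq_iff)
    then show False using k(1) z(2) by simp
  qed
  then have notin: "\<not> (\<exists>u\<in>?S. \<forall>i\<in>UNIV. u i = homog 1 z i)"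
    by (metis UNIV_I ext)
  have sub: "homog 1 ` X \<subseteq> ?S"
  proof -
    have "x \<in> conv_TC X" if "x \<in> X" for x using that hull_inc unfolding conv_TC_def by metis
    then show ?thesis unfolding cone_over_def by (auto intro!: exI[of _ 1])
  qed
  have "\<exists>b. (\<forall>x\<in>X. weakly_nonneg UNIV b (homog 1 x)) \<and> \<not> weakly_nonneg UNIV b (homog 1 z)"
  proof (rule ccontr)
    assume "\<not> ?thesis"
    then have "weakly_nonneg UNIV b (homog 1 z)" if "\<And>v. v \<in> homog 1 ` X \<Longrightarrow> weakly_nonneg UNIV b v" for b
      using that by blast
    then show False
      using tc_cone_separation[OF finite tc_cone_cone_over[OF TC_convex_conv_TC[OF X(2)]] _ sub] X(1) notin by blast
  qed
  then obtain b where b: "\<And>x. x \<in> X \<Longrightarrow> weakly_nonneg UNIV b (homog 1 x)" "\<not> weakly_nonneg UNIV b (homog 1 z)"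
    by blast
  define c where "c = of_val (b None)"
  define a :: "symtrop ^ 'd" where "a = (\<chi> j. of_val (b (Some j)))"
  have ca: "c \<in> T_signed" "a \<in> T_signed_vec"
    by (simp_all add: c_def a_def T_signed_vec_def of_val_signed)
  have "homog c a i = b i" for i by (cases i) (simp_all add: c_def a_def)
  then have "homog c a = b" by (rule ext)
  then have mem: "x \<in> closed_halfspace c a \<longleftrightarrow> weakly_nonneg UNIV b (homog 1 x)" if "x \<in> T_signed_vec" for x
    using mem_closed_halfspace[OF ca that] by simp
  have "X \<subseteq> closed_halfspace c a" using mem b(1) X(2) by blast
  moreover have "z \<notin> closed_halfspace c a" using mem b(2) z(1) by blast
  ultimately show ?thesis using that ca by blast
qed

section \<open>Halfspaces, their complements and TO-hulls\<close>

lemma TC_convex_closed_halfspace: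
  assumes "c \<in> T_signed" "a \<in> T_signed_vec" "a \<noteq> 0"
  shows "TC_convex (closed_halfspace c a)"
proof -
  have "closed_halfspace c a \<in> closed_halfspaces" using assms unfolding closed_halfspaces_def by blast
  then show ?thesis unfolding TC_convex_def conv_TC2_def by (auto simp: closed_halfspace_def)
qed

text \<open>\<open>v\<close> is a possible value of \<open>p \<oplus> q\<close> once balanced sums are resolved by \<open>U_set\<close>.\<close>

definition signed_mix :: "real \<Rightarrow> real \<Rightarrow> real \<Rightarrow> bool" where
  "signed_mix p q v \<longleftrightarrow> v = p \<and> \<bar>q\<bar> \<le> \<bar>p\<bar> \<or> v = q \<and> \<bar>p\<bar> \<le> \<bar>q\<bar> \<or> p = - q \<and> \<bar>v\<bar> \<le> \<bar>p\<bar>"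

lemma signed_mix_sym: "signed_mix p q v \<longleftrightarrow> signed_mix q p v"
  unfolding signed_mix_def by auto

lemma signed_mix_mult: "signed_mix p q v \<Longrightarrow> signed_mix (c * p) (c * q) (c * v)"
  unfolding signed_mix_def by (auto simp: abs_mult mult_left_mono)

lemma signed_mix_less: "signed_mix p q v \<Longrightarrow> p < T \<Longrightarrow> q < T \<Longrightarrow> v < T"
  unfolding signed_mix_def by linarith

lemma signed_mix_le: "signed_mix (- T) q v \<Longrightarrow> 0 < T \<Longrightarrow> q < T \<Longrightarrow> v \<le> - T"
  unfolding signed_mix_def by linarith

text \<open>A balanced sum forces \<open>val f = - val g\<close>, and \<open>U_set\<close> is the
  interval between these; any other sum is a summand of largest norm.\<close>

lemma U_set_mix:
  assumes "f \<in> T_signed" "g \<in> T_signed" "x \<in> U_set (f + g)"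
  shows "x \<in> T_signed \<and> signed_mix (val f) (val g) (val x)"
proof (cases "f + g \<in> T_bal")
  case False
  then have "x = f + g" using assms(3) by (simp add: U_set_def)
  then show ?thesis using assms(1,2) False
    by (elim T_signed_cases)
      (auto simp: signed_mix_def plus_symtrop_def T_bal_def T_signed_def T_pos_def T_neg_def zero_symtrop_def split: if_splits)
next
  case True
  then have x: "x \<in> T_signed" "tle (- tnorm (f + g)) x" "tle x (tnorm (f + g))"
    using assms(3) by (auto simp: U_set_def)
  have bal: "val f = - val g \<and> (f + g = TZero \<and> val f = 0 \<or> (\<exists>r. f + g = TNum TBal r \<and> \<bar>val f\<bar> = exp r))"
    using True assms(1,2)
    by (elim T_signed_cases) (auto simp: plus_symtrop_def T_bal_def zero_symtrop_def split: if_splits)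
  moreover have "\<bar>val x\<bar> \<le> \<bar>val f\<bar>"
    using bal x
    by (elim T_signed_cases disjE conjE exE)
      (auto simp: tle_def tless_def plus_symtrop_def uminus_symtrop_def T_pos_def split: if_splits)
  ultimately show ?thesis using x(1) by (auto simp: signed_mix_def)
qed

lemma weakly_nonneg_signed_mix_aux:
  assumes mix: "\<And>i. signed_mix (l * y1 i) (m * y2 i) (x i)"
    and i1: "i1 \<in> E" "a i1 * y1 i1 < 0" "\<And>j. j \<in> E \<Longrightarrow> a j * y1 j < - (a i1 * y1 i1)"
    and i2: "\<And>j. j \<in> E \<Longrightarrow> m * (a j * y2 j) < - (l * (a i1 * y1 i1))"
    and l: "0 < l"
  shows "\<not> weakly_nonneg E a x"
proof
  assume w: "weakly_nonneg E a x"
  define T where "T = - (l * (a i1 * y1 i1))"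
  have T: "T > 0" using l i1(2) by (simp add: T_def mult_pos_neg)
  have mix': "signed_mix (l * (a i * y1 i)) (m * (a i * y2 i)) (a i * x i)" for i
    using signed_mix_mult[OF mix, of "a i"] by (simp add: mult.left_commute)
  have 1: "l * (a j * y1 j) < T" if "j \<in> E" for j
    using mult_strict_left_mono[OF i1(3)[OF that] l] by (simp add: T_def)
  have 2: "m * (a j * y2 j) < T" if "j \<in> E" for j using i2[OF that] by (simp add: T_def)
  have lt: "a j * x j < T" if "j \<in> E" for j
    using signed_mix_less[OF mix' 1[OF that] 2[OF that]] .
  have "a i1 * x i1 \<le> - T"
    using signed_mix_le[OF _ T 2[OF i1(1)]] mix'[of i1] by (simp add: T_def)
  moreover from this obtain j where "j \<in> E" "- (a i1 * x i1) \<le> a j * x j"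
    using w i1(1) T unfolding weakly_nonneg_def by fastforce
  ultimately show False using lt[of j] by linarith
qed

text \<open>TO-convexity of the complement of a halfspace: if \<open>y1\<close> and
  \<open>y2\<close> both have an unmatched negative term, the larger one after scaling stays
  unmatched in the mix.\<close>

lemma weakly_nonneg_signed_mix:
  assumes mix: "\<And>i. signed_mix (l * y1 i) (m * y2 i) (x i)"
    and lm: "0 \<le> l" "0 \<le> m" "0 < max l m" and x: "weakly_nonneg E a x"
  shows "weakly_nonneg E a y1 \<or> weakly_nonneg E a y2"
proof (rule ccontr)
  assume "\<not> ?thesis"
  then obtain i1 i2 where i1: "i1 \<in> E" "a i1 * y1 i1 < 0" "\<And>j. j \<in> E \<Longrightarrow> a j * y1 j < - (a i1 * y1 i1)"
    and i2: "i2 \<in> E" "a i2 * y2 i2 < 0" "\<And>j. j \<in> E \<Longrightarrow> a j * y2 j < - (a i2 * y2 i2)"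
    unfolding weakly_nonneg_def by (auto simp: not_le)
  define T1 T2 where "T1 = - (l * (a i1 * y1 i1))" and "T2 = - (m * (a i2 * y2 i2))"
  have T0: "0 \<le> T1" "0 \<le> T2" using lm i1(2) i2(2) by (simp_all add: T1_def T2_def mult_nonneg_nonpos)
  have le1: "l * (a j * y1 j) \<le> T1" "l > 0 \<Longrightarrow> l * (a j * y1 j) < T1" if "j \<in> E" for j
    using mult_left_mono[OF less_imp_le[OF i1(3)[OF that]] lm(1)] mult_strict_left_mono[OF i1(3)[OF that]]
    by (simp_all add: T1_def)
  have le2: "m * (a j * y2 j) \<le> T2" "m > 0 \<Longrightarrow> m * (a j * y2 j) < T2" if "j \<in> E" for j
    using mult_left_mono[OF less_imp_le[OF i2(3)[OF that]] lm(2)] mult_strict_left_mono[OF i2(3)[OF that]]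
    by (simp_all add: T2_def)
  have pos: "l > 0 \<Longrightarrow> T1 > 0" "m > 0 \<Longrightarrow> T2 > 0"
    using i1(2) i2(2) by (simp_all add: T1_def T2_def mult_pos_neg)
  show False
  proof (cases "T2 \<le> T1")
    case True
    have l: "l > 0"
    proof (rule ccontr)
      assume "\<not> ?thesis"
      then have "l = 0" "m > 0" using lm by auto
      then show False using pos(2) True by (simp add: T1_def)
    qed
    have bound: "m * (a j * y2 j) < T1" if "j \<in> E" for j
      using le2[OF that] True pos(1)[OF l] lm(2) by (cases "m = 0") auto
    have "\<not> weakly_nonneg E a x"
      by (rule weakly_nonneg_signed_mix_aux[of l y1 m y2 x i1]) (use mix i1 bound l in \<open>simp_all add: T1_def\<close>)
    then show False using x by simp
  next
    case False
    then have m: "m > 0" using T0 lm(2) by (cases "m = 0") (auto simp: T2_def)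
    have bound: "l * (a j * y1 j) < T2" if "j \<in> E" for j
      using le1(1)[OF that] False by linarith
    have "\<not> weakly_nonneg E a x"
      by (rule weakly_nonneg_signed_mix_aux[of m y2 l y1 x i2])
        (use mix[THEN signed_mix_sym[THEN iffD1]] i2 bound m in \<open>simp_all add: T2_def\<close>)
    then show False using x by simp
  qed
qed

lemma conv_TO_closed_halfspace:
  fixes x :: "symtrop ^ 'd"
  assumes c: "c \<in> T_signed" "a \<in> T_signed_vec" and y: "y1 \<in> T_signed_vec" "y2 \<in> T_signed_vec"
    and x: "x \<in> conv_TO y1 y2" "x \<in> closed_halfspace c a"
  shows "y1 \<in> closed_halfspace c a \<or> y2 \<in> closed_halfspace c a"
proof -
  obtain l m where lm: "l \<in> T_nonneg" "m \<in> T_nonneg" "l + m = 1" "x \<in> U_vec (l *s y1 + m *s y2)"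
    using x(1) unfolding conv_TO_def by blast
  have sgn: "l \<in> T_signed" "m \<in> T_signed" "0 \<le> val l" "0 \<le> val m"
    using lm(1,2) by (auto simp: T_nonneg_def T_signed_def T_pos_def zero_symtrop_def)
  \<comment> \<open>The normalisation \<open>l + m = 1\<close> becomes the mix condition at the
    coordinate \<open>None\<close>.\<close>
  have "1 \<in> U_set (l + m)" unfolding lm(3)
    by (auto simp: U_set_def T_bal_def one_symtrop_def zero_symtrop_def)
  then have one: "signed_mix (val l) (val m) 1"
    using U_set_mix[OF sgn(1,2), of 1] by simp
  have "signed_mix (val l * homog 1 y1 i) (val m * homog 1 y2 i) (homog 1 x i)" for i
  proof (cases i)
    case None
    then show ?thesis using one by simp
  next
    case (Some j)
    have "x $ j \<in> U_set (l * y1 $ j + m * y2 $ j)" using lm(4) by (simp add: U_vec_def)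
    moreover have "y1 $ j \<in> T_signed" "y2 $ j \<in> T_signed" using y by (simp_all add: T_signed_vec_def)
    ultimately show ?thesis
      using U_set_mix T_signed_mult[OF sgn(1)] T_signed_mult[OF sgn(2)] Some by (metis homog_simps(2))
  qed
  moreover have "0 < max (val l) (val m)" using one sgn(3,4) by (auto simp: signed_mix_def)
  moreover have "x \<in> T_signed_vec" using x(2) by (simp add: closed_halfspace_def)
  ultimately show ?thesis
    using weakly_nonneg_signed_mix[of "val l" "homog 1 y1" "val m" "homog 1 y2" "homog 1 x" UNIV "homog c a"] sgn(3,4)
      x(2) y mem_closed_halfspace[OF c] by blast
qed

theorem theorem4p7:
  fixes X :: "(symtrop ^ 'd) set" and x0 y1 y2 :: "symtrop ^ 'd"
  assumes "finite X" and "X \<subseteq> T_signed_vec" and "x0 \<in> X"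
    and "y1 \<in> T_signed_vec" and "y2 \<in> T_signed_vec"
    and "x0 \<in> conv_TO y1 y2"
  shows "conv_TC (X \<union> {y1}) \<inter> conv_TC (X \<union> {y2}) = conv_TC X"
proof
  show "conv_TC X \<subseteq> conv_TC (X \<union> {y1}) \<inter> conv_TC (X \<union> {y2})"
    unfolding conv_TC_def by (intro Int_greatest hull_mono) auto
  show "conv_TC (X \<union> {y1}) \<inter> conv_TC (X \<union> {y2}) \<subseteq> conv_TC X"
  proof
    fix z assume z: "z \<in> conv_TC (X \<union> {y1}) \<inter> conv_TC (X \<union> {y2})"
    have "X \<union> {y1} \<subseteq> T_signed_vec" using assms by auto
    from TC_convex_conv_TC[OF this] have zT: "z \<in> T_signed_vec"
      using z unfolding TC_convex_def by blast
    show "z \<in> conv_TC X"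
    proof (rule ccontr)
      assume "z \<notin> conv_TC X"
      then obtain c a where ca: "c \<in> T_signed" "a \<in> T_signed_vec"
        and H: "X \<subseteq> closed_halfspace c a" "z \<notin> closed_halfspace c a"
        using TC_separation[OF assms(1,2) zT] by blast
      \<comment> \<open>Otherwise the halfspace would be everything or empty, but it contains
        \<open>x0\<close> and misses \<open>z\<close>.\<close>
      have "a \<noteq> 0"
      proof
        assume "a = 0"
        then have "closed_halfspace c a = T_signed_vec \<or> closed_halfspace c a = {}"
          by (auto simp: closed_halfspace_def)
        then show False using H zT assms(3) by auto
      qed
      then have conv: "conv_TC (X \<union> {y}) \<subseteq> closed_halfspace c a" if "y \<in> closed_halfspace c a" for y
        unfolding conv_TC_def using that H(1) TC_convex_closed_halfspace[OF ca]
        by (intro hull_minimal) auto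
      have "y1 \<in> closed_halfspace c a \<or> y2 \<in> closed_halfspace c a"
        using conv_TO_closed_halfspace[OF ca assms(4-6)] H(1) assms(3) by blast
      then show False using conv z H(2) by blast
    qed
  qed
qed

end
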